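(* Let $\nu>2$ and let $\rho$ be a semimetric on $\mathcal F$. Assume: (1) There exists $g:\mathbb N\times(0,\infty)\to\mathbb R$ such that for each $n\in\mathbb N$, $\delta>0$ and $1\le i\le j\le n$, $\mathrm E^*\{\sup_{f\in\mathcal F_\delta}|S_{n,i,j}^{Z^o}(f)|^\nu\}\le g^{\nu/2}(j-i+1,\delta)$; and there exists a single index $Q_g\in[1,2^{1-2/\nu})$ such that for each $\delta>0$ the pair $(\nu/2,g(\cdot,\delta))$ fulfills condition (S) with index $Q_g$. (2) There exists $h:\mathbb N\to\mathbb R$ such that for each $n\in\mathbb N$ and $1\le i\le j\le n$, $\mathrm E^*\{\sup_{f\in\mathcal F}|S_{n,i,j}^{Z^o}(f)|^\nu\}\le h^{\nu/2}(j-i+1)$; and the pair $(\nu/2,h)$ fulfills condition (S) with some index $Q_h\in[1,2^{1-2/\nu})$. (3) $\lim_{\delta\downarrow0}\limsup_{n\to\infty} g(n,\delta)/n=0$. (4) There exists a constant $C\ge0$ such that for each $0<\varepsilon\le1$, $\limsup_{n\to\infty} h(\lfloor n\varepsilon\rfloor)/n\le C\varepsilon$ (with the convention $h(0)=0$). Then $\mathbb Z_n$ satisfies (AEC) for the semimetric $\tau((s,f),(t,g))=|s-t|+\rho(f,g)$ on $[0,1]\times\mathcal F$. If, in addition, $(\mathcal F,\rho)$ is totally bounded, then convergence of the finite-dimensional marginals of $\mathbb Z_n$ to those of a tight Borel measurable $\mathbb Z$ implies weak convergence $\mathbb Z_n\Rightarrow\mathbb Z$ in $\ell^\infty([0,1]\times\mathcal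 F)$.
   Context: Let $(\Omega,\Upsilon,P)$ be a probability space, $(\mathcal X,\mathcal A)$ a measurable space, and $(X_{i,n})_{1\le i\le n,\,n\in\mathbb N}$ an array of $\mathcal X$-valued random variables. $\mathcal F$ is a family of Borel measurable maps $\mathcal X\to\mathbb R$ possessing a finite measurable envelope $F$, i.e. $\sup_{f\in\mathcal F}|f(x)|\le F(x)<\infty$ for all $x$ and $\mathrm E\{F(X_{i,n})\}<\infty$ for all $i,n$. The sequential empirical process is $\mathbb Z_n(t,f)=n^{-1/2}\sum_{i=1}^{\lfloor nt\rfloor}(f(X_{i,n})-\mathrm E f(X_{i,n}))$, $t\in[0,1]$, $f\in\mathcal F$, viewed as a (possibly nonmeasurable) map into $\ell^\infty([0,1]\times\mathcal F)$ (bounded functions with sup norm). $\mathcal F_\delta=\{f-g: f,g\in\mathcal F,\ \rho(f,g)\le\delta\}$. For $g\in\mathcal F\cup\bigcup_{\delta>0}\mathcal F_\delta$, $Z^o_{k,n}(g)=g(X_{k,n})-\mathrm E g(X_{k,n})$ and $S^{Z^o}_{n,i,j}(g)=\sum_{k=i}^j Z^o_{k,n}(g)$. $\mathrm E^*$ and $P^*$ denote outer expectation and outer probability ($P^*(B)=\inf\{P(A):B\subset A\in\Upsilon\}$). Condition (S): for $\alpha>1$ and $g:\mathbb N\to\mathbb R$, $(\alpha,g)$ fulfills (S) with index $Q\in[1,2^{(\alpha-1)/\alpha})$ if $g\ge0$, $g$ is nondecreasing, and $g(i)+g(j-i)\le Qg(j)$ for all $1\le i<j$. (AEC) for $\tau$: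 for every $\varepsilon>0$, $\lim_{\delta\downarrow0}\limsup_{n\to\infty}P^*(\sup_{\tau((s,f),(t,g))\le\delta}|\mathbb Z_n(s,f)-\mathbb Z_n(t,g)|>\varepsilon)=0$. Weak convergence $\mathbb Z_n\Rightarrow\mathbb Z$ (Hoffmann-Jørgensen sense) means $\mathrm E^*\{h(\mathbb Z_n)\}\to\mathrm E\{h(\mathbb Z)\}$ for all bounded continuous $h:\ell^\infty([0,1]\times\mathcal F)\to\mathbb R$. *)

theory Defs
  imports "HOL-Probability.Probability"
begin

definition outer_nn_exp :: "'w measure \<Rightarrow> ('w \<Rightarrow> ennreal) \<Rightarrow> ennreal" where
  "outer_nn_exp M T =
     (INF U \<in> {U \<in> borel_measurable M. \<forall>x\<in>space M. T x \<le> U x}. nn_integral M U)"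

definition outer_exp :: "'w measure \<Rightarrow> ('w \<Rightarrow> real) \<Rightarrow> real" where
  "outer_exp M T =
     Inf {integral\<^sup>L M U | U. U \<in> borel_measurable M \<and> integrable M U \<and>
                              (\<forall>x\<in>space M. T x \<le> U x)}"

definition outer_prob :: "'w measure \<Rightarrow> 'w set \<Rightarrow> real" where
  "outer_prob M B = Inf (measure M ` {A \<in> sets M. B \<inter> space M \<subseteq> A})"

definition borel_of :: "'a topology \<Rightarrow> 'a measure" where
  "borel_of X = sigma (topspace X) {U. openin X U}"

definition cond_S :: "real \<Rightarrow> (nat \<Rightarrow> real) \<Rightarrow> real \<Rightarrow> bool" where
  "cond_S \<alpha> g Q \<longleftrightarrow> \<alpha> > 1 \<and> 1 \<le> Q \<and> Q < 2 powr ((\<alpha> - 1) / \<alpha>) \<and>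
     (\<forall>i\<ge>1. 0 \<le> g i) \<and> (\<forall>i j. 1 \<le> i \<longrightarrow> i \<le> j \<longrightarrow> g i \<le> g j) \<and>
     (\<forall>i j. 1 \<le> i \<longrightarrow> i < j \<longrightarrow> g i + g (j - i) \<le> Q * g j)"

definition semimetric_on :: "'a set \<Rightarrow> ('a \<Rightarrow> 'a \<Rightarrow> real) \<Rightarrow> bool" where
  "semimetric_on A d \<longleftrightarrow> (\<forall>x\<in>A. \<forall>y\<in>A. 0 \<le> d x y \<and> d x y = d y x) \<and> (\<forall>x\<in>A. d x x = 0) \<and>
     (\<forall>x\<in>A. \<forall>y\<in>A. \<forall>z\<in>A. d x z \<le> d x y + d y z)"

definition totally_bounded_semi :: "'a set \<Rightarrow> ('a \<Rightarrow> 'a \<Rightarrow> real) \<Rightarrow> bool" where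
  "totally_bounded_semi A d \<longleftrightarrow>
     (\<forall>e>0. \<exists>K. finite K \<and> K \<subseteq> A \<and> (\<forall>x\<in>A. \<exists>k\<in>K. d x k < e))"

definition Fdelta :: "('x \<Rightarrow> real) set \<Rightarrow> (('x \<Rightarrow> real) \<Rightarrow> ('x \<Rightarrow> real) \<Rightarrow> real) \<Rightarrow> real
                     \<Rightarrow> ('x \<Rightarrow> real) set" where
  "Fdelta F \<rho> \<delta> = {(\<lambda>x. f x - g x) | f g. f \<in> F \<and> g \<in> F \<and> \<rho> f g \<le> \<delta>}"

definition Zo :: "'w measure \<Rightarrow> (nat \<Rightarrow> nat \<Rightarrow> 'w \<Rightarrow> 'x) \<Rightarrow> ('x \<Rightarrow> real) \<Rightarrow> nat \<Rightarrow> nat \<Rightarrow> 'w \<Rightarrow> real" where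
  "Zo M X g k n \<omega> = g (X k n \<omega>) - integral\<^sup>L M (\<lambda>\<omega>'. g (X k n \<omega>'))"

definition SZo :: "'w measure \<Rightarrow> (nat \<Rightarrow> nat \<Rightarrow> 'w \<Rightarrow> 'x) \<Rightarrow> nat \<Rightarrow> nat \<Rightarrow> nat \<Rightarrow> ('x \<Rightarrow> real) \<Rightarrow> 'w \<Rightarrow> real" where
  "SZo M X n i j g \<omega> = (\<Sum>k = i..j. Zo M X g k n \<omega>)"

definition seqemp :: "'w measure \<Rightarrow> (nat \<Rightarrow> nat \<Rightarrow> 'w \<Rightarrow> 'x) \<Rightarrow> nat \<Rightarrow> real \<Rightarrow> ('x \<Rightarrow> real) \<Rightarrow> 'w \<Rightarrow> real" where
  "seqemp M X n t f \<omega> = (1 / sqrt (real n)) *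
      (\<Sum>i = 1..nat \<lfloor>real n * t\<rfloor>. f (X i n \<omega>) - integral\<^sup>L M (\<lambda>\<omega>'. f (X i n \<omega>')))"

text \<open>Index set [0,1] x F, the space l^\<infinity>([0,1] x F) with sup metric (functions are
  extensional, i.e. undefined outside the index set), and Z_n as an element of it.\<close>
definition idx :: "('x \<Rightarrow> real) set \<Rightarrow> (real \<times> ('x \<Rightarrow> real)) set" where
  "idx F = {0..1} \<times> F"

definition linf :: "('x \<Rightarrow> real) set \<Rightarrow> (real \<times> ('x \<Rightarrow> real) \<Rightarrow> real) metric" where
  "linf F = funspace (idx F) euclidean_metric"

definition Zproc :: "'w measure \<Rightarrow> (nat \<Rightarrow> nat \<Rightarrow> 'w \<Rightarrow> 'x) \<Rightarrow> ('x \<Rightarrow> real) set \<Rightarrow> nat \<Rightarrow> 'w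
                     \<Rightarrow> (real \<times> ('x \<Rightarrow> real) \<Rightarrow> real)" where
  "Zproc M X F n \<omega> = restrict (\<lambda>(t, f). seqemp M X n t f \<omega>) (idx F)"

end

theory Submission
  imports Defs
begin

text \<open>
  A maximal inequality of Moricz-Serfling-Stout type holds for the suprema over a function class,
  with outer expectations.  For \<open>|s - t| + \<rho> f\<^sub>1 f\<^sub>2 \<le> \<delta>\<close>, the increment of the process splits into a
  partial sum of \<open>f\<^sub>1 - f\<^sub>2 \<in> \<F>\<^sub>\<delta>\<close>, controlled by \<open>g(n,\<delta>)/n\<close>, and an increment in time, controlled by
  the maxima over roughly \<open>1/\<delta>\<close> blocks of length \<open>L = \<lfloor>2n\<delta>\<rfloor>\<close>.  The latter contribute
  \<open>(1/\<delta>) (h(L)/n) powr (\<nu>/2)\<close>, which vanishes with \<open>\<delta>\<close> because \<open>\<nu> > 2\<close>.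

  For the weak convergence, bounded continuous functionals are approximated from below and from
  above by Lipschitz ones.  A Lipschitz functional of the process is close to one of its
  discretisation along a finite net: for the process itself by equicontinuity, and for the limit
  because tightness makes finitely many coordinates detect a large discretisation error, so
  that equicontinuity passes to the limit through the finite-dimensional marginals.
\<close>

section \<open>Outer expectations and the maximal inequality\<close>

text \<open>Neither the suprema over \<open>\<F>\<close> nor \<open>Zproc\<close> as a map into
  \<open>linf\<close> need be measurable, so neither can simply be integrated. For moments, the
  infimum in \<open>outer_nn_exp\<close> is attained by a measurable majorant, which yields
  monotonicity, subadditivity and Markov's inequality. No independence enters: the dependence
  between the variables is visible only through moment bounds for single blocks, and condition (S),
  superadditivity up to the factor \<open>Q\<close>, is what lets bisection pass from single blocks
  to maxima. Maxima are needed because one event involves all pairs of times at once. The bounds for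
  \<open>\<F>\<close> itself carry no small factor in \<delta>, so smallness in time has to come
  from short blocks, and the price is their number. For weak convergence, the usual detour through
  asymptotic tightness and Prokhorov's theorem is bypassed: the limit \<open>Z\<close> is given
  together with its tightness, so expectations can be compared directly. The obstacle is that
  nothing is known about the continuity of the paths of \<open>Z\<close>, and that a supremum over
  \<open>idx \<F>\<close> is not a function of finitely many coordinates.\<close>

lemma outer_nn_exp_attained:
  obtains U where "U \<in> borel_measurable M" "\<And>x. x \<in> space M \<Longrightarrow> T x \<le> U x"
    "nn_integral M U = outer_nn_exp M T"
proof -
  define \<U> where "\<U> = {U \<in> borel_measurable M. \<forall>x\<in>space M. T x \<le> U x}"
  have "(\<lambda>_. top) \<in> \<U>"
    by (auto simp: \<U>_def)
  then have "nn_integral M ` \<U> \<noteq> {}"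
    by blast
  \<comment> \<open>A countable minimising family is essential: the pointwise infimum of countably
    many measurable majorants is again a measurable majorant.\<close>
  from ennreal_Inf_countable_INF[OF this] obtain c :: "nat \<Rightarrow> ennreal"
    where c: "range c \<subseteq> nn_integral M ` \<U>" "Inf (nn_integral M ` \<U>) = (INF i. c i)"
    by auto
  have "\<exists>U\<in>\<U>. c i = nn_integral M U" for i
    using range_subsetD[OF c(1), of i] by blast
  then obtain U where U: "\<And>i. U i \<in> \<U>" "\<And>i. c i = nn_integral M (U i)"
    by metis
  let ?V = "\<lambda>x. INF i. U i x"
  have V: "?V \<in> borel_measurable M" "\<And>x. x \<in> space M \<Longrightarrow> T x \<le> ?V x"
    using U(1) by (auto simp: \<U>_def intro!: borel_measurable_INF INF_greatest)
  have "nn_integral M ?V \<le> outer_nn_exp M T"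
    unfolding outer_nn_exp_def \<U>_def[symmetric] c(2)
    by (auto intro!: INF_greatest nn_integral_mono INF_lower simp: U(2))
  moreover have "outer_nn_exp M T \<le> nn_integral M ?V"
    unfolding outer_nn_exp_def using V by (intro INF_lower) auto
  ultimately show ?thesis
    using V that by (metis antisym)
qed

lemma outer_nn_exp_le:
  assumes "U \<in> borel_measurable M" "\<And>x. x \<in> space M \<Longrightarrow> T x \<le> U x"
  shows "outer_nn_exp M T \<le> nn_integral M U"
  unfolding outer_nn_exp_def using assms by (intro INF_lower) auto

lemma outer_nn_exp_mono:
  assumes "\<And>x. x \<in> space M \<Longrightarrow> T x \<le> T' x"
  shows "outer_nn_exp M T \<le> outer_nn_exp M T'"
proof -
  obtain U where "U \<in> borel_measurable M" "\<And>x. x \<in> space M \<Longrightarrow> T' x \<le> U x"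
    "nn_integral M U = outer_nn_exp M T'"
    using outer_nn_exp_attained by blast
  then show ?thesis
    using outer_nn_exp_le[of U M T] assms by (metis order_trans)
qed

lemma outer_nn_exp_add:
  "outer_nn_exp M (\<lambda>x. T x + T' x) \<le> outer_nn_exp M T + outer_nn_exp M T'"
proof -
  obtain U where U: "U \<in> borel_measurable M" "\<And>x. x \<in> space M \<Longrightarrow> T x \<le> U x"
    "nn_integral M U = outer_nn_exp M T"
    using outer_nn_exp_attained by blast
  obtain U' where U': "U' \<in> borel_measurable M" "\<And>x. x \<in> space M \<Longrightarrow> T' x \<le> U' x"
    "nn_integral M U' = outer_nn_exp M T'"
    using outer_nn_exp_attained by blast
  have "outer_nn_exp M (\<lambda>x. T x + T' x) \<le> nn_integral M (\<lambda>x. U x + U' x)"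
    using U U' by (intro outer_nn_exp_le) (auto intro: add_mono)
  then show ?thesis
    using U U' by (simp add: nn_integral_add)
qed

lemma outer_nn_exp_cmult:
  "outer_nn_exp M (\<lambda>x. c * T x) \<le> c * outer_nn_exp M T"
proof -
  obtain U where U: "U \<in> borel_measurable M" "\<And>x. x \<in> space M \<Longrightarrow> T x \<le> U x"
    "nn_integral M U = outer_nn_exp M T"
    using outer_nn_exp_attained by blast
  have "outer_nn_exp M (\<lambda>x. c * T x) \<le> nn_integral M (\<lambda>x. c * U x)"
    using U by (intro outer_nn_exp_le) (auto intro: mult_left_mono)
  then show ?thesis
    using U by (simp add: nn_integral_cmult)
qed

lemma outer_nn_exp_zero: "outer_nn_exp M (\<lambda>x. 0) = 0"
  using outer_nn_exp_le[of "\<lambda>_. 0" M "\<lambda>_. 0"] by auto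

lemma outer_nn_exp_sum:
  "outer_nn_exp M (\<lambda>x. \<Sum>i\<in>I. T i x) \<le> (\<Sum>i\<in>I. outer_nn_exp M (T i))"
proof (induction I rule: infinite_finite_induct)
  case (insert j I)
  have "outer_nn_exp M (\<lambda>x. \<Sum>i\<in>insert j I. T i x)
      \<le> outer_nn_exp M (T j) + outer_nn_exp M (\<lambda>x. \<Sum>i\<in>I. T i x)"
    using insert outer_nn_exp_add[of M "T j" "\<lambda>x. \<Sum>i\<in>I. T i x"] by simp
  also have "\<dots> \<le> outer_nn_exp M (T j) + (\<Sum>i\<in>I. outer_nn_exp M (T i))"
    using insert by (intro add_left_mono)
  finally show ?case
    using insert by simp
qed (auto simp: outer_nn_exp_zero)

section \<open>Outer probability and Markov's inequality\<close>

lemma outer_prob_le: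
  assumes "A \<in> sets M" "B \<inter> space M \<subseteq> A"
  shows "outer_prob M B \<le> measure M A"
  unfolding outer_prob_def using assms by (intro cInf_lower) (auto intro!: bdd_belowI[of _ 0])

lemma outer_prob_nonneg: "0 \<le> outer_prob M B"
  unfolding outer_prob_def by (intro cInf_greatest) auto

lemma outer_prob_approx:
  assumes "outer_prob M B < c"
  obtains A where "A \<in> sets M" "B \<inter> space M \<subseteq> A" "measure M A < c"
proof -
  have "measure M ` {A \<in> sets M. B \<inter> space M \<subseteq> A} \<noteq> {}"
    by auto
  from cInf_lessD[OF this assms[unfolded outer_prob_def]] show ?thesis
    using that by auto
qed

lemma outer_prob_mono:
  assumes "B \<inter> space M \<subseteq> C"
  shows "outer_prob M B \<le> outer_prob M C"
  unfolding outer_prob_def[of M C]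
proof (rule cInf_greatest)
  fix x assume "x \<in> measure M ` {A \<in> sets M. C \<inter> space M \<subseteq> A}"
  then show "outer_prob M B \<le> x"
    using assms by (auto intro!: outer_prob_le)
qed auto

text \<open>A level set of an attained majorant of \<open>T\<close> is a measurable cover of
  \<open>B\<close>, so the usual argument applies to that majorant.\<close>

lemma (in finite_measure) outer_prob_Markov:
  assumes "\<And>x. x \<in> B \<Longrightarrow> x \<in> space M \<Longrightarrow> ennreal c \<le> T x"
    and "0 < c" "0 \<le> a" "outer_nn_exp M T \<le> ennreal a"
  shows "outer_prob M B \<le> a / c"
proof -
  obtain U where U: "U \<in> borel_measurable M" "\<And>x. x \<in> space M \<Longrightarrow> T x \<le> U x"
    "nn_integral M U = outer_nn_exp M T"
    using outer_nn_exp_attained by blast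
  let ?A = "{x \<in> space M. ennreal c \<le> U x}"
  have A: "?A \<in> sets M"
    using U by measurable
  have "ennreal (c * measure M ?A) = (\<integral>\<^sup>+x. ennreal c * indicator ?A x \<partial>M)"
    using A assms by (simp add: nn_integral_cmult emeasure_eq_measure ennreal_mult)
  also have "\<dots> \<le> nn_integral M U"
    by (intro nn_integral_mono) (auto split: split_indicator)
  also have "\<dots> \<le> ennreal a"
    using U assms by simp
  finally have "c * measure M ?A \<le> a"
    using assms by simp
  then have "measure M ?A \<le> a / c"
    using assms by (simp add: field_simps)
  moreover have "outer_prob M B \<le> measure M ?A"
    using A assms U by (intro outer_prob_le) (auto intro: order_trans)
  ultimately show ?thesis
    by simp
qed

section \<open>Maximal inequality by bisection\<close>

text \<open>Write \<open>a + b\<close> as the convex combination of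
  \<open>a / (1 - \<theta>)\<close> and \<open>b / \<theta>\<close> with weights
  \<open>1 - \<theta>\<close> and \<open>\<theta>\<close>, and apply convexity of the power. If
  \<open>a\<close> or \<open>b\<close> vanishes, it suffices that both coefficients are at least
  1.\<close>

lemma powr_add_le_weighted:
  fixes a b \<theta> \<nu> :: real
  assumes "0 \<le> a" "0 \<le> b" "0 < \<theta>" "\<theta> < 1" "1 \<le> \<nu>"
  shows "(a + b) powr \<nu> \<le> (1 - \<theta>) powr (1 - \<nu>) * a powr \<nu> + \<theta> powr (1 - \<nu>) * b powr \<nu>"
proof -
  have ge1: "1 \<le> t powr (1 - \<nu>)" if "0 < t" "t < 1" for t :: real
    using that assms powr_mono'[of "1 - \<nu>" 0 t] by simp
  consider "a = 0" | "b = 0" | "0 < a" "0 < b"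
    using assms by linarith
  then show ?thesis
  proof cases
    case 1
    then show ?thesis
      using ge1[of \<theta>] assms mult_right_mono[of 1 "\<theta> powr (1 - \<nu>)" "b powr \<nu>"] by simp
  next
    case 2
    then show ?thesis
      using ge1[of "1 - \<theta>"] assms mult_right_mono[of 1 "(1 - \<theta>) powr (1 - \<nu>)" "a powr \<nu>"]
      by simp
  next
    case 3
    have eq: "t * (x / t) powr \<nu> = t powr (1 - \<nu>) * x powr \<nu>" if "0 < t" "0 < x" for t x :: real
      using that by (simp add: powr_divide powr_diff)
    have "((1 - \<theta>) *\<^sub>R (a / (1 - \<theta>)) + \<theta> *\<^sub>R (b / \<theta>)) powr \<nu>
        \<le> (1 - \<theta>) * (a / (1 - \<theta>)) powr \<nu> + \<theta> * (b / \<theta>) powr \<nu>"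
      using 3 assms by (intro convex_onD[OF powr_convex]) auto
    then show ?thesis
      using 3 assms by (simp add: eq)
  qed
qed

text \<open>The smaller half carries at most the average of the two values that (S) bounds. Since
  \<open>Q < 2\<close>, passing to a half block is a genuine contraction of
  \<open>G\<close>.\<close>

lemma cond_S_half:
  assumes "cond_S \<alpha> G Q" "2 \<le> n"
  shows "G (n div 2) \<le> Q / 2 * G n"
proof -
  have "G (n div 2) \<le> G (n - n div 2)"
    using assms unfolding cond_S_def by auto
  moreover have "G (n div 2) + G (n - n div 2) \<le> Q * G n"
    using assms unfolding cond_S_def by auto
  ultimately show ?thesis
    by simp
qed

text \<open>This is the classical constant \<open>(1 - \<theta>) powr (- \<nu>)\<close> with
  \<open>\<theta>\<close> the square root of \<open>Q / 2 powr (1 - 2 / \<nu>)\<close>. The upper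
  limit imposed on the index in (S) says exactly that \<open>\<theta> < 1\<close>.\<close>

definition moricz_const :: "real \<Rightarrow> real \<Rightarrow> real" where
  "moricz_const \<nu> Q = (1 / (1 - sqrt (2 powr (2 / \<nu> - 1) * Q))) powr \<nu>"

text \<open>Convexity of \<open>x powr \<nu>\<close> replaces Minkowski's inequality, so that only subadditivity of the
  outer expectation is needed.  Splitting a block in its middle turns a constant \<open>A\<close> into
  \<open>(1 - \<theta>) powr (1 - \<nu>) + \<theta> * A\<close> with \<open>\<theta>\<close> as below, and the constant is the fixed point of this map.\<close>
lemma moricz_maximal_inequality:
  fixes Y :: "nat \<Rightarrow> 'f \<Rightarrow> 'w \<Rightarrow> real" and D :: "'f set"
  assumes S: "cond_S (\<nu> / 2) G Q" and nu: "\<nu> > 2"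
    and bnd: "\<And>i k. 1 \<le> i \<Longrightarrow> 1 \<le> k \<Longrightarrow>
      outer_nn_exp M (\<lambda>\<omega>. SUP f\<in>D. ennreal (\<bar>\<Sum>l=i..<i+k. Y l f \<omega>\<bar> powr \<nu>))
        \<le> ennreal (G k powr (\<nu> / 2))"
    and "1 \<le> i" "1 \<le> n"
  shows "outer_nn_exp M (\<lambda>\<omega>. SUP k\<in>{1..n}. SUP f\<in>D. ennreal (\<bar>\<Sum>l=i..<i+k. Y l f \<omega>\<bar> powr \<nu>))
        \<le> ennreal (moricz_const \<nu> Q * G n powr (\<nu> / 2))"
proof -
  define \<theta> where "\<theta> = sqrt (2 powr (2 / \<nu> - 1) * Q)"
  define K where "K = moricz_const \<nu> Q"
  have "(\<nu> / 2 - 1) / (\<nu> / 2) = 1 - 2 / \<nu>"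
    using nu by (simp add: field_simps)
  then have Q: "1 \<le> Q" "Q < 2 powr (1 - 2 / \<nu>)"
    using S unfolding cond_S_def by auto
  have Gnn: "0 \<le> G k" if "1 \<le> k" for k
    using S that unfolding cond_S_def by auto
  have Gmono: "G k \<le> G l" if "1 \<le> k" "k \<le> l" for k l
    using S that unfolding cond_S_def by auto
  have "2 powr (2 / \<nu> - 1) * Q < 2 powr (2 / \<nu> - 1) * 2 powr (1 - 2 / \<nu>)"
    using Q by simp
  also have "\<dots> = 1"
    by (simp flip: powr_add)
  finally have \<theta>: "0 < \<theta>" "\<theta> < 1"
    using Q by (auto simp: \<theta>_def)
  have K: "K = (1 - \<theta>) powr (- \<nu>)"
    using \<theta> by (simp add: K_def moricz_const_def flip: \<theta>_def)
      (simp add: powr_divide powr_minus_divide)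
  \<comment> \<open>The two half blocks together shrink the bound by the factor
    \<open>2 * (Q / 2) powr (\<nu> / 2)\<close>, and \<open>\<theta>\<close> is its
    \<open>\<nu>\<close>-th root. With this weight convexity loses nothing against Minkowski, whose
    recursion \<open>K powr (1 / \<nu>) = 1 + \<theta> * K powr (1 / \<nu>)\<close> has the same
    solution.\<close>
  have \<theta>nu: "\<theta> powr \<nu> = 2 * (Q / 2) powr (\<nu> / 2)"
  proof -
    have "\<theta> powr \<nu> = (2 powr (2 / \<nu> - 1) * Q) powr (\<nu> / 2)"
      using Q by (simp add: \<theta>_def powr_half_sqrt[symmetric] powr_powr)
    also have "\<dots> = 2 powr ((2 / \<nu> - 1) * (\<nu> / 2)) * Q powr (\<nu> / 2)"
      using Q by (simp add: powr_mult powr_powr)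
    also have "(2 / \<nu> - 1) * (\<nu> / 2) = 1 - \<nu> / 2"
      using nu by (simp add: field_simps)
    also have "2 powr (1 - \<nu> / 2) * Q powr (\<nu> / 2) = 2 * (Q / 2) powr (\<nu> / 2)"
      using Q by (simp add: powr_diff powr_divide)
    finally show ?thesis .
  qed
  define c1 c2 where "c1 = (1 - \<theta>) powr (1 - \<nu>)" and "c2 = \<theta> powr (1 - \<nu>)"
  have c: "1 \<le> c1" "1 \<le> c2"
    using \<theta> nu powr_mono'[of "1 - \<nu>" 0 "1 - \<theta>"] powr_mono'[of "1 - \<nu>" 0 \<theta>]
    by (auto simp: c1_def c2_def)
  have K1: "1 \<le> K"
    using \<theta> nu powr_mono'[of "- \<nu>" 0 "1 - \<theta>"] by (simp add: K)
  have fixpoint: "c1 + c2 * \<theta> powr \<nu> * K = K"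
  proof -
    have "c1 = (1 - \<theta>) * K"
      using \<theta> by (simp add: c1_def K powr_diff powr_minus_divide)
    moreover have "c2 * \<theta> powr \<nu> = \<theta>"
      using \<theta> by (simp add: c2_def flip: powr_add)
    ultimately show ?thesis
      by (simp add: algebra_simps)
  qed
  define T where "T = (\<lambda>i k \<omega>. SUP f\<in>D. ennreal (\<bar>\<Sum>l=i..<i+k. Y l f \<omega>\<bar> powr \<nu>))"
  have T_upper: "ennreal (\<bar>\<Sum>l=i..<i+k. Y l f \<omega>\<bar> powr \<nu>) \<le> T i k \<omega>" if "f \<in> D" for i k f \<omega>
    unfolding T_def using that by (rule SUP_upper)
  have "outer_nn_exp M (\<lambda>\<omega>. SUP k\<in>{1..n}. T i k \<omega>) \<le> ennreal (K * G n powr (\<nu> / 2))"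
    using \<open>1 \<le> i\<close> \<open>1 \<le> n\<close>
  proof (induction n arbitrary: i rule: less_induct)
    case (less n)
    show ?case
    proof (cases "n = 1")
      case True
      have "G 1 powr (\<nu> / 2) \<le> K * G 1 powr (\<nu> / 2)"
        using K1 mult_right_mono[of 1 K "G 1 powr (\<nu> / 2)"] by simp
      then have *: "ennreal (G 1 powr (\<nu> / 2)) \<le> ennreal (K * G 1 powr (\<nu> / 2))"
        by (rule ennreal_leI)
      have "outer_nn_exp M (T i 1) \<le> ennreal (G 1 powr (\<nu> / 2))"
        unfolding T_def using bnd[of i 1] less.prems by simp
      from order_trans[OF this *] show ?thesis
        using True by simp
    next
      case False
      then have n: "2 \<le> n"
        using less.prems by simp
      \<comment> \<open>The pivot is the partial sum of length \<open>p + 1\<close>. A shorter sum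
        has length at most \<open>p\<close>, a longer one is the pivot plus at most \<open>r\<close>
        further terms; so both recursive maxima run over lengths at most \<open>n div 2\<close>,
        where the halving estimate applies.\<close>
      define p r where "p = (n - 1) div 2" and "r = n div 2"
      have pr: "p + 1 + r = n" "p \<le> r" "1 \<le> r" "r < n"
        using n by (auto simp: p_def r_def)
      define b where "b = K * (\<theta> powr \<nu> * G n powr (\<nu> / 2)) / 2"
      have Gr: "K * G k powr (\<nu> / 2) \<le> b" if "1 \<le> k" "k \<le> r" for k
      proof -
        have "G k \<le> Q / 2 * G n"
          using Gmono[OF that] cond_S_half[OF S n] by (simp add: r_def)
        then have "G k powr (\<nu> / 2) \<le> (Q / 2 * G n) powr (\<nu> / 2)"
          using Gnn that nu by (intro powr_mono2) auto
        also have "\<dots> = \<theta> powr \<nu> * G n powr (\<nu> / 2) / 2"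
          using powr_mult[of "Q / 2" "G n" "\<nu> / 2"] Q Gnn[OF less.prems(2)] by (simp add: \<theta>nu)
        finally show ?thesis
          using K1 mult_left_mono[of "G k powr (\<nu> / 2)" _ K] by (simp add: b_def)
      qed
      define M1 M2 where "M1 = (\<lambda>\<omega>. SUP k\<in>{1..p}. T i k \<omega>)"
        and "M2 = (\<lambda>\<omega>. SUP k\<in>{1..r}. T (i + (p + 1)) k \<omega>)"
      have b0: "0 \<le> b"
        using K1 by (simp add: b_def)
      have bb: "ennreal b + ennreal b = ennreal (2 * b)"
        using b0 by (metis ennreal_plus mult_2)
      have M1: "outer_nn_exp M M1 \<le> ennreal b"
      proof (cases "p = 0")
        case True
        then have "M1 = (\<lambda>_. 0)"
          by (simp add: M1_def bot_ennreal)
        then show ?thesis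
          by (simp add: outer_nn_exp_zero)
      next
        case False
        then have "outer_nn_exp M M1 \<le> ennreal (K * G p powr (\<nu> / 2))"
          unfolding M1_def using less.prems pr by (intro less.IH) auto
        also have "\<dots> \<le> ennreal b"
          using False pr by (intro ennreal_leI Gr) auto
        finally show ?thesis .
      qed
      have "outer_nn_exp M M2 \<le> ennreal (K * G r powr (\<nu> / 2))"
        unfolding M2_def using less.prems pr by (intro less.IH) auto
      also have "\<dots> \<le> ennreal b"
        using pr by (intro ennreal_leI Gr) auto
      finally have M2: "outer_nn_exp M M2 \<le> ennreal b" .
      \<comment> \<open>The pivot is a single block, so the hypothesis bounds it directly, without
        the constant \<open>K\<close>. Its crude bound by \<open>G n\<close> supplies the
        inhomogeneous term \<open>c1\<close> of the recursion.\<close>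
      have T0: "outer_nn_exp M (T i (p + 1)) \<le> ennreal (G n powr (\<nu> / 2))"
      proof -
        have "G (p + 1) powr (\<nu> / 2) \<le> G n powr (\<nu> / 2)"
          using Gmono[of "p + 1" n] Gnn pr nu by (intro powr_mono2) auto
        then show ?thesis
          using bnd[of i "p + 1"] less.prems unfolding T_def by (meson ennreal_leI le_add2 order_trans)
      qed
      have pt: "(SUP k\<in>{1..n}. T i k \<omega>)
          \<le> ennreal c1 * T i (p + 1) \<omega> + ennreal c2 * (M1 \<omega> + M2 \<omega>)" for \<omega>
      proof (rule SUP_least)
        fix k assume k: "k \<in> {1..n}"
        show "T i k \<omega> \<le> ennreal c1 * T i (p + 1) \<omega> + ennreal c2 * (M1 \<omega> + M2 \<omega>)"
        proof (cases "k \<le> p")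
          case True
          then have "T i k \<omega> \<le> M1 \<omega>"
            unfolding M1_def using k by (intro SUP_upper) auto
          also have "\<dots> \<le> 1 * (M1 \<omega> + M2 \<omega>)"
            by simp
          also have "\<dots> \<le> ennreal c2 * (M1 \<omega> + M2 \<omega>)"
            using c by (intro mult_right_mono) auto
          finally show ?thesis
            by (simp add: add_increasing)
        next
          case False
          define q where "q = k - (p + 1)"
          have q: "k = p + 1 + q" "q \<le> r"
            using False k pr by (auto simp: q_def)
          \<comment> \<open>For \<open>q = 0\<close> the sum is empty and outside the range of the
            maximum \<open>M2\<close>, but its power is 0.\<close>
          have M2q: "ennreal (\<bar>\<Sum>l=i+(p+1)..<i+(p+1)+q. Y l f \<omega>\<bar> powr \<nu>) \<le> M2 \<omega>"
            if "f \<in> D" for f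
          proof (cases "q = 0")
            case False
            then have "T (i + (p + 1)) q \<omega> \<le> M2 \<omega>"
              unfolding M2_def using q by (intro SUP_upper) auto
            then show ?thesis
              using T_upper[OF that] order_trans by blast
          qed simp
          show ?thesis
            unfolding T_def
          proof (rule SUP_least)
            fix f assume f: "f \<in> D"
            let ?a = "\<bar>\<Sum>l=i..<i+(p+1). Y l f \<omega>\<bar>" and ?b = "\<bar>\<Sum>l=i+(p+1)..<i+(p+1)+q. Y l f \<omega>\<bar>"
            have "(\<Sum>l=i..<i+k. Y l f \<omega>)
                = (\<Sum>l=i..<i+(p+1). Y l f \<omega>) + (\<Sum>l=i+(p+1)..<i+(p+1)+q. Y l f \<omega>)"
              unfolding q by (subst sum.atLeastLessThan_concat) (auto simp: algebra_simps)
            then have "\<bar>\<Sum>l=i..<i+k. Y l f \<omega>\<bar> powr \<nu> \<le> (?a + ?b) powr \<nu>"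
              using nu by (intro powr_mono2) auto
            also have "\<dots> \<le> c1 * ?a powr \<nu> + c2 * ?b powr \<nu>"
              unfolding c1_def c2_def using \<theta> nu by (intro powr_add_le_weighted) auto
            finally have "ennreal (\<bar>\<Sum>l=i..<i+k. Y l f \<omega>\<bar> powr \<nu>)
                \<le> ennreal (c1 * ?a powr \<nu> + c2 * ?b powr \<nu>)"
              by (rule ennreal_leI)
            also have "\<dots> = ennreal c1 * ennreal (?a powr \<nu>) + ennreal c2 * ennreal (?b powr \<nu>)"
              using c by (simp add: ennreal_plus ennreal_mult)
            also have "\<dots> \<le> ennreal c1 * T i (p + 1) \<omega> + ennreal c2 * (M1 \<omega> + M2 \<omega>)"
            proof (intro add_mono mult_left_mono)
              show "ennreal (?b powr \<nu>) \<le> M1 \<omega> + M2 \<omega>"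
                using M2q[OF f] by (simp add: add_increasing)
            qed (rule T_upper[OF f], simp_all)
            finally show "ennreal (\<bar>\<Sum>l=i..<i+k. Y l f \<omega>\<bar> powr \<nu>) \<le>
              ennreal c1 * (SUP f\<in>D. ennreal (\<bar>\<Sum>l=i..<i+(p+1). Y l f \<omega>\<bar> powr \<nu>))
              + ennreal c2 * (M1 \<omega> + M2 \<omega>)"
              unfolding T_def .
          qed
        qed
      qed
      have "outer_nn_exp M (\<lambda>\<omega>. SUP k\<in>{1..n}. T i k \<omega>)
          \<le> outer_nn_exp M (\<lambda>\<omega>. ennreal c1 * T i (p + 1) \<omega> + ennreal c2 * (M1 \<omega> + M2 \<omega>))"
        using pt by (intro outer_nn_exp_mono)
      also have "\<dots> \<le> outer_nn_exp M (\<lambda>\<omega>. ennreal c1 * T i (p + 1) \<omega>)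
          + outer_nn_exp M (\<lambda>\<omega>. ennreal c2 * (M1 \<omega> + M2 \<omega>))"
        by (rule outer_nn_exp_add)
      also have "\<dots> \<le> ennreal c1 * outer_nn_exp M (T i (p + 1))
          + ennreal c2 * outer_nn_exp M (\<lambda>\<omega>. M1 \<omega> + M2 \<omega>)"
        by (intro add_mono outer_nn_exp_cmult)
      also have "\<dots> \<le> ennreal c1 * ennreal (G n powr (\<nu> / 2)) + ennreal c2 * (ennreal b + ennreal b)"
        by (intro add_mono mult_left_mono T0 order_trans[OF outer_nn_exp_add] M1 M2) auto
      also have "\<dots> = ennreal (c1 * G n powr (\<nu> / 2) + c2 * (2 * b))"
        unfolding bb using c b0 by (simp add: ennreal_plus ennreal_mult')
      also have "c1 * G n powr (\<nu> / 2) + c2 * (2 * b) = (c1 + c2 * \<theta> powr \<nu> * K) * G n powr (\<nu> / 2)"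
        by (simp add: b_def algebra_simps)
      finally show ?thesis
        unfolding fixpoint .
    qed
  qed
  then show ?thesis
    unfolding T_def K_def .
qed

section \<open>Asymptotic equicontinuity\<close>

lemma outer_prob_Un_le:
  assumes "finite_measure M"
  shows "outer_prob M (B \<union> C) \<le> outer_prob M B + outer_prob M C"
proof (rule field_le_epsilon)
  interpret finite_measure M by fact
  fix e :: real assume "0 < e"
  obtain A where A: "A \<in> sets M" "B \<inter> space M \<subseteq> A" "measure M A < outer_prob M B + e / 2"
    using outer_prob_approx[of M B "outer_prob M B + e / 2"] \<open>0 < e\<close> by auto
  obtain A' where A': "A' \<in> sets M" "C \<inter> space M \<subseteq> A'" "measure M A' < outer_prob M C + e / 2"
    using outer_prob_approx[of M C "outer_prob M C + e / 2"] \<open>0 < e\<close> by auto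
  have "outer_prob M (B \<union> C) \<le> measure M (A \<union> A')"
    using A A' by (intro outer_prob_le) auto
  also have "\<dots> \<le> measure M A + measure M A'"
    using A A' by (intro measure_Un_le)
  finally show "outer_prob M (B \<union> C) \<le> outer_prob M B + outer_prob M C + e"
    using A A' by simp
qed

text \<open>Since \<open>b - a\<close> is at most one block length, \<open>b\<close> lies in the
  block of \<open>a\<close> or in the next one. The path from \<open>a\<close> to \<open>b\<close>
  through the block starts then uses at most three increments, each taken from the start of a block;
  \<open>k = L\<close> is allowed so that a whole block counts as one of them.\<close>

lemma block_increments:
  fixes s :: "nat \<Rightarrow> real"
  assumes "1 \<le> L" "a \<le> b" "b \<le> n" "b - a \<le> L"
    and blocks: "\<And>q k. k \<le> L \<Longrightarrow> q * L + k \<le> n \<Longrightarrow> \<bar>s (q * L + k) - s (q * L)\<bar> \<le> c"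
  shows "\<bar>s b - s a\<bar> \<le> 3 * c"
proof -
  define q where "q = a div L"
  have a: "a = q * L + a mod L" "a mod L < L"
    using assms by (auto simp: q_def)
  have sa: "\<bar>s a - s (q * L)\<bar> \<le> c"
    using blocks[of "a mod L" q] a assms by simp
  show ?thesis
  proof (cases "b \<le> q * L + L")
    case True
    then have "\<bar>s b - s (q * L)\<bar> \<le> c"
      using blocks[of "b - q * L" q] a assms by simp
    then show ?thesis
      using sa by linarith
  next
    case False
    moreover have "b \<le> Suc q * L + L"
      using a assms(4) unfolding mult_Suc by linarith
    ultimately have "\<bar>s b - s (Suc q * L)\<bar> \<le> c"
      using blocks[of "b - Suc q * L" "Suc q"] assms(3) by simp
    moreover have "\<bar>s (Suc q * L) - s (q * L)\<bar> \<le> c"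
      using blocks[of L q] False assms by (simp add: add.commute)
    ultimately show ?thesis
      using sa by linarith
  qed
qed

text \<open>One lemma serves both kinds of increment: with \<open>L = n\<close> it bounds sums over
  \<open>\<F>\<^sub>\<delta>\<close>, with short \<open>L\<close> the increments in time. Markov's
  inequality is applied to the sum of the block maxima, hence the number of blocks as a
  factor.\<close>

lemma increment_tail_bound:
  fixes Y :: "nat \<Rightarrow> 'f \<Rightarrow> 'w \<Rightarrow> real" and D :: "'f set"
  assumes M: "finite_measure M"
    and S: "cond_S (\<nu> / 2) G Q" and nu: "\<nu> > 2"
    and bnd: "\<And>i j. 1 \<le> i \<Longrightarrow> i \<le> j \<Longrightarrow> j \<le> n \<Longrightarrow>
      outer_nn_exp M (\<lambda>\<omega>. SUP f\<in>D. ennreal (\<bar>\<Sum>l=i..j. Y l f \<omega>\<bar> powr \<nu>))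
        \<le> ennreal (G (j - i + 1) powr (\<nu> / 2))"
    and L: "1 \<le> L" and c: "0 < c"
  shows "outer_prob M {\<omega> \<in> space M. \<exists>a b f. a \<le> b \<and> b \<le> n \<and> b - a \<le> L \<and> f \<in> D \<and>
            3 * c < \<bar>\<Sum>l=a+1..b. Y l f \<omega>\<bar>}
         \<le> real (n div L + 1) * (moricz_const \<nu> Q * G L powr (\<nu> / 2)) / c powr \<nu>"
proof -
  interpret finite_measure M by fact
  \<comment> \<open>The last block may run past \<open>n\<close>, where no moment bound is assumed.
    Cutting the terms off there reduces it to a shorter block, and \<open>G\<close> is
    nondecreasing.\<close>
  define Y' where "Y' = (\<lambda>l f \<omega>. if l \<le> n then Y l f \<omega> else 0)"
  have bnd': "outer_nn_exp M (\<lambda>\<omega>. SUP f\<in>D. ennreal (\<bar>\<Sum>l=i..<i+k. Y' l f \<omega>\<bar> powr \<nu>))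
        \<le> ennreal (G k powr (\<nu> / 2))" if ik: "1 \<le> i" "1 \<le> k" for i k
  proof (cases "i \<le> n")
    case True
    define j where "j = min n (i + k - 1)"
    have j: "i \<le> j" "j \<le> n" "j - i + 1 \<le> k"
      using True ik by (auto simp: j_def)
    have "(\<Sum>l=i..<i+k. Y' l f \<omega>) = (\<Sum>l=i..j. Y l f \<omega>)" for f \<omega>
      unfolding Y'_def using ik
      by (subst sum.inter_filter[symmetric]) (auto simp: j_def intro!: sum.cong)
    then have "outer_nn_exp M (\<lambda>\<omega>. SUP f\<in>D. ennreal (\<bar>\<Sum>l=i..<i+k. Y' l f \<omega>\<bar> powr \<nu>))
        \<le> ennreal (G (j - i + 1) powr (\<nu> / 2))"
      using bnd[OF ik(1) j(1,2)] by simp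
    also have "\<dots> \<le> ennreal (G k powr (\<nu> / 2))"
      using S j nu unfolding cond_S_def by (intro ennreal_leI powr_mono2) auto
    finally show ?thesis .
  next
    case False
    then have "(\<Sum>l=i..<i+k. Y' l f \<omega>) = 0" for f \<omega>
      by (intro sum.neutral) (auto simp: Y'_def)
    then have "outer_nn_exp M (\<lambda>\<omega>. SUP f\<in>D. ennreal (\<bar>\<Sum>l=i..<i+k. Y' l f \<omega>\<bar> powr \<nu>))
        \<le> outer_nn_exp M (\<lambda>\<omega>. 0)"
      by (intro outer_nn_exp_mono SUP_least) simp
    then show ?thesis
      by (simp add: outer_nn_exp_zero)
  qed
  \<comment> \<open>Block \<open>q\<close> consists of the indices \<open>q * L + 1\<close> to
    \<open>q * L + L\<close>, because the increment between the partial sums at \<open>q * L\<close>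
    and \<open>q * L + k\<close> starts one index later. The value \<open>q = n div L\<close> is the
    incomplete last block.\<close>
  define T where "T = (\<lambda>q \<omega>. SUP k\<in>{1..L}. SUP f\<in>D.
      ennreal (\<bar>\<Sum>l=q*L+1..<q*L+1+k. Y' l f \<omega>\<bar> powr \<nu>))"
  define A where "A = moricz_const \<nu> Q * G L powr (\<nu> / 2)"
  have A0: "0 \<le> A"
    by (simp add: A_def moricz_const_def)
  have "outer_nn_exp M (T q) \<le> ennreal A" for q
    unfolding A_def T_def by (rule moricz_maximal_inequality[OF S nu bnd']) (use L in auto)
  then have "(\<Sum>q\<le>n div L. outer_nn_exp M (T q)) \<le> (\<Sum>q\<le>n div L. ennreal A)"
    by (intro sum_mono)
  also have "\<dots> = ennreal (real (n div L + 1) * A)"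
    using A0 by (simp add: ennreal_mult ennreal_of_nat_eq_real_of_nat add.commute)
  finally have E: "outer_nn_exp M (\<lambda>\<omega>. \<Sum>q\<le>n div L. T q \<omega>) \<le> ennreal (real (n div L + 1) * A)"
    using outer_nn_exp_sum[of M T "{..n div L}"] by (rule order_trans[rotated])
  have "ennreal (c powr \<nu>) \<le> (\<Sum>q\<le>n div L. T q \<omega>)"
    if abf: "a \<le> b" "b \<le> n" "b - a \<le> L" "f \<in> D" "3 * c < \<bar>\<Sum>l=a+1..b. Y l f \<omega>\<bar>" for \<omega> a b f
  proof -
    define s where "s = (\<lambda>m. \<Sum>l=1..<m+1. Y l f \<omega>)"
    have s_diff: "s b - s a = (\<Sum>l=a+1..<b+1. Y l f \<omega>)" if "a \<le> b" for a b
      using sum_diff_nat_ivl[of 1 "a + 1" "b + 1" "\<lambda>l. Y l f \<omega>"] that by (simp add: s_def)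
    have "\<exists>q k. k \<le> L \<and> q * L + k \<le> n \<and> c < \<bar>s (q * L + k) - s (q * L)\<bar>"
    proof (rule ccontr)
      assume "\<not> ?thesis"
      then have "\<bar>s b - s a\<bar> \<le> 3 * c"
        using L abf by (intro block_increments[of L]) (auto simp: not_less)
      then show False
        using abf s_diff[OF abf(1)] by (simp add: atLeastLessThanSuc_atLeastAtMost)
    qed
    then obtain q k where qk: "k \<le> L" "q * L + k \<le> n" "c < \<bar>s (q * L + k) - s (q * L)\<bar>"
      by blast
    then have k: "1 \<le> k"
      using c by (cases k) auto
    have q: "q \<le> n div L"
      using qk(2) L by (simp add: less_eq_div_iff_mult_less_eq)
    have "s (q * L + k) - s (q * L) = (\<Sum>l=q*L+1..<q*L+1+k. Y' l f \<omega>)"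
      using qk by (subst s_diff) (auto simp: Y'_def intro!: sum.cong)
    then have "c powr \<nu> \<le> \<bar>\<Sum>l=q*L+1..<q*L+1+k. Y' l f \<omega>\<bar> powr \<nu>"
      using qk c nu by (intro powr_mono2) auto
    then have "ennreal (c powr \<nu>) \<le> ennreal (\<bar>\<Sum>l=q*L+1..<q*L+1+k. Y' l f \<omega>\<bar> powr \<nu>)"
      by (rule ennreal_leI)
    also have "\<dots> \<le> T q \<omega>"
      unfolding T_def using k qk abf by (intro SUP_upper2[of k] SUP_upper) auto
    also have "\<dots> \<le> (\<Sum>q\<le>n div L. T q \<omega>)"
      using q by (intro member_le_sum) auto
    finally show ?thesis .
  qed
  then show ?thesis
    unfolding A_def[symmetric] using c A0 E
    by (intro outer_prob_Markov[where T = "\<lambda>\<omega>. \<Sum>q\<le>n div L. T q \<omega>"]) auto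
qed

lemma seqemp_eq:
  "seqemp M X n t f \<omega> = (\<Sum>k=1..nat \<lfloor>real n * t\<rfloor>. Zo M X f k n \<omega>) / sqrt (real n)"
  by (simp add: seqemp_def Zo_def)

lemma nat_floor_mult_le:
  assumes "t \<in> {0..1}"
  shows "nat \<lfloor>real n * t\<rfloor> \<le> n"
proof -
  have "real n * t \<le> real n"
    using assms by (simp add: mult_left_le)
  then show ?thesis
    by linarith
qed

text \<open>Rounding down adds less than 1 to the real difference \<open>n * \<delta>\<close>, and
  this 1 is absorbed by a second \<open>n * \<delta>\<close>. This is the source of the block length
  with factor 2.\<close>

lemma nat_floor_diff_le:
  fixes s t \<delta> :: real
  assumes "0 \<le> s" "0 \<le> t" "\<bar>s - t\<bar> \<le> \<delta>" "1 \<le> real n * \<delta>"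
  shows "nat \<lfloor>real n * t\<rfloor> - nat \<lfloor>real n * s\<rfloor> \<le> nat \<lfloor>real n * (2 * \<delta>)\<rfloor>"
proof -
  have "real n * (t - s) \<le> real n * \<delta>"
    using assms by (intro mult_left_mono) auto
  then have "real n * t \<le> real n * s + real n * \<delta>"
    by (simp add: algebra_simps)
  moreover have "0 \<le> real n * s" "0 \<le> real n * t"
    using assms by auto
  moreover have "real n * (2 * \<delta>) = real n * \<delta> + real n * \<delta>"
    by simp
  ultimately show ?thesis
    using assms(4) by linarith
qed

lemma tendsto_powr_at_right_0:
  assumes "0 < p"
  shows "((\<lambda>r::real. r powr p) \<longlongrightarrow> 0) (at_right 0)"
proof (rule tendsto_zero_powrI[OF tendsto_ident_at tendsto_const _ assms])
  show "eventually (\<lambda>r::real. 0 \<le> r) (at_right 0)"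
    using eventually_at_right_less by (rule eventually_mono) simp
qed

lemma asymptotic_equicontinuity:
  fixes M :: "'w measure" and X :: "nat \<Rightarrow> nat \<Rightarrow> 'w \<Rightarrow> 'x"
    and \<F> :: "('x \<Rightarrow> real) set" and \<rho> :: "('x \<Rightarrow> real) \<Rightarrow> ('x \<Rightarrow> real) \<Rightarrow> real"
    and g :: "nat \<Rightarrow> real \<Rightarrow> real" and h :: "nat \<Rightarrow> real" and C \<epsilon> :: real
  assumes M: "finite_measure M"
    and int: "\<And>f i n. f \<in> \<F> \<Longrightarrow> 1 \<le> i \<Longrightarrow> i \<le> n \<Longrightarrow> integrable M (\<lambda>\<omega>. f (X i n \<omega>))"
    and nu: "\<nu> > 2"
    and rho: "\<And>f f'. f \<in> \<F> \<Longrightarrow> f' \<in> \<F> \<Longrightarrow> 0 \<le> \<rho> f f'"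
    and A1: "\<And>n i j \<delta>. \<delta> > 0 \<Longrightarrow> 1 \<le> i \<Longrightarrow> i \<le> j \<Longrightarrow> j \<le> n \<Longrightarrow>
               outer_nn_exp M (\<lambda>\<omega>. SUP f \<in> Fdelta \<F> \<rho> \<delta>. ennreal (\<bar>SZo M X n i j f \<omega>\<bar> powr \<nu>))
                 \<le> ennreal (g (j - i + 1) \<delta> powr (\<nu> / 2))"
    and A1S: "\<And>\<delta>. \<delta> > 0 \<Longrightarrow> cond_S (\<nu> / 2) (\<lambda>k. g k \<delta>) Qg"
    and A2: "\<And>n i j. 1 \<le> i \<Longrightarrow> i \<le> j \<Longrightarrow> j \<le> n \<Longrightarrow>
               outer_nn_exp M (\<lambda>\<omega>. SUP f \<in> \<F>. ennreal (\<bar>SZo M X n i j f \<omega>\<bar> powr \<nu>))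
                 \<le> ennreal (h (j - i + 1) powr (\<nu> / 2))"
    and A2S: "cond_S (\<nu> / 2) h Qh"
    and A3: "((\<lambda>\<delta>. limsup (\<lambda>n. ereal (g n \<delta> / real n))) \<longlongrightarrow> 0) (at_right 0)"
    and C: "0 \<le> C"
    and A4: "\<And>\<epsilon>. 0 < \<epsilon> \<Longrightarrow> \<epsilon> \<le> 1 \<Longrightarrow>
               limsup (\<lambda>n. ereal ((let k = nat \<lfloor>real n * \<epsilon>\<rfloor> in if k = 0 then 0 else h k) / real n))
                 \<le> ereal (C * \<epsilon>)"
    and eps: "0 < \<epsilon>"
  shows "((\<lambda>\<delta>. limsup (\<lambda>n. ereal (outer_prob M
              {\<omega> \<in> space M. \<exists>s t f1 f2. s \<in> {0..1} \<and> t \<in> {0..1} \<and> f1 \<in> \<F> \<and> f2 \<in> \<F> \<and>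
                  \<bar>s - t\<bar> + \<rho> f1 f2 \<le> \<delta> \<and>
                  \<bar>seqemp M X n s f1 \<omega> - seqemp M X n t f2 \<omega>\<bar> > \<epsilon>})))
             \<longlongrightarrow> 0) (at_right 0)"
proof -
  define E where "E n \<delta> = {\<omega> \<in> space M. \<exists>s t f1 f2. s \<in> {0..1} \<and> t \<in> {0..1} \<and>
      f1 \<in> \<F> \<and> f2 \<in> \<F> \<and> \<bar>s - t\<bar> + \<rho> f1 f2 \<le> \<delta> \<and>
      \<bar>seqemp M X n s f1 \<omega> - seqemp M X n t f2 \<omega>\<bar> > \<epsilon>}" for n \<delta>
  define Ag Ah where "Ag = (6 / \<epsilon>) powr \<nu> * (2 * moricz_const \<nu> Qg)"
    and "Ah = (6 / \<epsilon>) powr \<nu> * moricz_const \<nu> Qh"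
  have A_nonneg: "0 \<le> Ag" "0 \<le> Ah"
    by (auto simp: Ag_def Ah_def moricz_const_def)
  have nonneg: "0 \<le> g n \<delta>" "0 \<le> h n" if "1 \<le> n" "0 < \<delta>" for n \<delta>
    using A1S A2S that unfolding cond_S_def by auto
  have bound: "outer_prob M (E n \<delta>) \<le> Ag * (g n \<delta> / n) powr (\<nu> / 2)
        + real (n div L + 1) * Ah * (h L / n) powr (\<nu> / 2)"
    if n: "1 \<le> n" and \<delta>: "0 < \<delta>" "1 \<le> real n * \<delta>" and L: "L = nat \<lfloor>real n * (2 * \<delta>)\<rfloor>" for n \<delta> L
  proof -
    \<comment> \<open>The threshold \<open>\<epsilon> * sqrt n\<close> is shared by two increments,
      each of which costs three block increments: hence the 6.\<close>
    define c where "c = \<epsilon> * sqrt n / 6"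
    have c: "0 < c"
      using eps n by (simp add: c_def)
    have L1: "1 \<le> L"
      using \<delta> unfolding L by linarith
    define E1 E2 where
      "E1 = {\<omega> \<in> space M. \<exists>a b f. a \<le> b \<and> b \<le> n \<and> b - a \<le> n \<and> f \<in> Fdelta \<F> \<rho> \<delta> \<and>
            3 * c < \<bar>\<Sum>l=a+1..b. Zo M X f l n \<omega>\<bar>}"
      and "E2 = {\<omega> \<in> space M. \<exists>a b f. a \<le> b \<and> b \<le> n \<and> b - a \<le> L \<and> f \<in> \<F> \<and>
            3 * c < \<bar>\<Sum>l=a+1..b. Zo M X f l n \<omega>\<bar>}"
    have "E n \<delta> \<subseteq> E1 \<union> E2"
    proof
      fix \<omega> assume "\<omega> \<in> E n \<delta>"
      then obtain s t f1 f2 where \<omega>: "\<omega> \<in> space M" and st: "s \<in> {0..1}" "t \<in> {0..1}"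
        and f: "f1 \<in> \<F>" "f2 \<in> \<F>" and d: "\<bar>s - t\<bar> + \<rho> f1 f2 \<le> \<delta>"
        and gt: "\<bar>seqemp M X n s f1 \<omega> - seqemp M X n t f2 \<omega>\<bar> > \<epsilon>"
        unfolding E_def by blast
      define a b where "a = nat \<lfloor>real n * s\<rfloor>" and "b = nat \<lfloor>real n * t\<rfloor>"
      have ab: "a \<le> n" "b \<le> n"
        unfolding a_def b_def using st nat_floor_mult_le by auto
      have "b - a \<le> L" "a - b \<le> L"
        unfolding a_def b_def L using st d \<delta> rho[OF f] by (auto intro!: nat_floor_diff_le)
      define u where "u = (\<lambda>f m. \<Sum>k=1..m. Zo M X f k n \<omega>)"
      have u_diff: "u f b - u f a = (\<Sum>k=a+1..b. Zo M X f k n \<omega>)" if "a \<le> b" for f a b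
        using sum_diff_nat_ivl[of 1 "a + 1" "b + 1" "\<lambda>k. Zo M X f k n \<omega>"] that
        by (simp add: u_def atLeastLessThanSuc_atLeastAtMost)
      have "seqemp M X n s f1 \<omega> - seqemp M X n t f2 \<omega> = (u f1 a - u f2 b) / sqrt n"
        by (simp add: seqemp_eq u_def a_def b_def diff_divide_distrib)
      then have "\<epsilon> * sqrt n < \<bar>u f1 a - u f2 b\<bar>"
        using gt n by (simp add: abs_divide less_divide_eq)
      then have "6 * c < \<bar>u f1 a - u f2 a\<bar> + \<bar>u f2 a - u f2 b\<bar>"
        by (simp add: c_def)
      then consider "3 * c < \<bar>u f1 a - u f2 a\<bar>" | "3 * c < \<bar>u f2 a - u f2 b\<bar>"
        by linarith
      then show "\<omega> \<in> E1 \<union> E2"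
      proof cases
        case 1
        have "(\<lambda>x. f1 x - f2 x) \<in> Fdelta \<F> \<rho> \<delta>"
          unfolding Fdelta_def using f d abs_ge_zero[of "s - t"] by force
        \<comment> \<open>Centring is linear only because both functions are integrable along the
          array. The sum starts at 0 and has at most \<open>n\<close> terms, so it is an increment
          allowed in \<open>E1\<close>.\<close>
        moreover have "u f1 a - u f2 a = (\<Sum>k=0+1..a. Zo M X (\<lambda>x. f1 x - f2 x) k n \<omega>)"
          unfolding u_def sum_subtractf[symmetric] using ab f
          by (auto intro!: sum.cong simp: Zo_def int Bochner_Integration.integral_diff)
        ultimately have "\<omega> \<in> E1"
          unfolding E1_def using \<omega> ab 1 by fastforce
        then show ?thesis ..
      next
        case 2
        have "\<omega> \<in> E2"
        proof (cases "a \<le> b")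
          case True
          then have "3 * c < \<bar>\<Sum>k=a+1..b. Zo M X f2 k n \<omega>\<bar>"
            using 2 u_diff[of a b f2] by simp
          then show ?thesis
            unfolding E2_def using \<omega> True ab \<open>b - a \<le> L\<close> f by blast
        next
          case False
          then have "3 * c < \<bar>\<Sum>k=b+1..a. Zo M X f2 k n \<omega>\<bar>"
            using 2 u_diff[of b a f2] by simp
          then show ?thesis
            unfolding E2_def using \<omega> False ab \<open>a - b \<le> L\<close> f
            by (intro CollectI conjI exI[of _ b] exI[of _ a] exI[of _ f2]) auto
        qed
        then show ?thesis ..
      qed
    qed
    then have "outer_prob M (E n \<delta>) \<le> outer_prob M (E1 \<union> E2)"
      by (intro outer_prob_mono) auto
    also have "\<dots> \<le> outer_prob M E1 + outer_prob M E2"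
      using M by (rule outer_prob_Un_le)
    also have "outer_prob M E1 \<le> real (n div n + 1) * (moricz_const \<nu> Qg * g n \<delta> powr (\<nu> / 2)) / c powr \<nu>"
      unfolding E1_def
      by (rule increment_tail_bound[OF M A1S nu A1[unfolded SZo_def]]) (use \<delta> n c in auto)
    also have "outer_prob M E2 \<le> real (n div L + 1) * (moricz_const \<nu> Qh * h L powr (\<nu> / 2)) / c powr \<nu>"
      unfolding E2_def
      by (rule increment_tail_bound[OF M A2S nu A2[unfolded SZo_def]]) (use L1 c in auto)
    \<comment> \<open>The power \<open>n powr (\<nu> / 2)\<close> coming from the normalisation
      turns \<open>g n \<delta>\<close> and \<open>h L\<close> into the quotients by
      \<open>n\<close> that the hypotheses control. The 2 in \<open>Ag\<close> is the block count
      \<open>n div n + 1\<close>.\<close>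
    also have "c powr \<nu> = (\<epsilon> / 6) powr \<nu> * real n powr (\<nu> / 2)"
      using eps by (simp add: c_def powr_half_sqrt[symmetric] powr_mult[symmetric] powr_powr[symmetric])
        (simp add: powr_mult powr_powr powr_divide)
    also have "real (n div n + 1) * (moricz_const \<nu> Qg * g n \<delta> powr (\<nu> / 2)) /
          ((\<epsilon> / 6) powr \<nu> * real n powr (\<nu> / 2)) = Ag * (g n \<delta> / n) powr (\<nu> / 2)"
      using n eps nonneg \<delta> by (simp add: Ag_def powr_divide)
    also have "real (n div L + 1) * (moricz_const \<nu> Qh * h L powr (\<nu> / 2)) /
          ((\<epsilon> / 6) powr \<nu> * real n powr (\<nu> / 2)) = real (n div L + 1) * Ah * (h L / n) powr (\<nu> / 2)"
      using n L1 eps nonneg \<delta> by (simp add: Ah_def powr_divide)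
    finally show ?thesis
      by simp
  qed
  have small: "eventually (\<lambda>\<delta>. limsup (\<lambda>n. ereal (outer_prob M (E n \<delta>))) \<le> ereal \<eta>) (at_right 0)"
    if \<eta>: "0 < \<eta>" for \<eta> :: real
  proof -
    have "((\<lambda>r. Ag * r powr (\<nu> / 2)) \<longlongrightarrow> 0) (at_right 0)"
      using nu by (intro tendsto_mult_right_zero tendsto_powr_at_right_0) simp
    then have "eventually (\<lambda>r. Ag * r powr (\<nu> / 2) < \<eta> / 2) (at_right 0)"
      using \<eta> by (intro order_tendstoD(2)) auto
    with eventually_at_right_less[of 0] have "eventually (\<lambda>r. 0 < r \<and> Ag * r powr (\<nu> / 2) < \<eta> / 2) (at_right 0)"
      by eventually_elim auto
    from eventually_happens[OF this] obtain r where r: "0 < r" "Ag * r powr (\<nu> / 2) < \<eta> / 2"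
      by auto
    have ev1: "eventually (\<lambda>\<delta>. limsup (\<lambda>n. ereal (g n \<delta> / real n)) < ereal r) (at_right 0)"
      using r by (intro order_tendstoD(2)[OF A3]) auto
    \<comment> \<open>The time part is at most \<open>(1 / \<delta> + 1) * Ah * (2 * (C + 1) *
      \<delta>) powr (\<nu> / 2)\<close>. Its leading power of \<open>\<delta>\<close> is
      \<open>\<nu> / 2 - 1\<close>, which is positive.\<close>
    define D where "D = (2 * (C + 1)) powr (\<nu> / 2)"
    have "((\<lambda>\<delta>. Ah * D * (\<delta> powr (\<nu> / 2 - 1) + \<delta> powr (\<nu> / 2))) \<longlongrightarrow> 0) (at_right 0)"
      using nu by (intro tendsto_mult_right_zero tendsto_add_zero tendsto_powr_at_right_0) auto
    then have ev2: "eventually (\<lambda>\<delta>. Ah * D * (\<delta> powr (\<nu> / 2 - 1) + \<delta> powr (\<nu> / 2)) < \<eta> / 2) (at_right 0)"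
      using \<eta> by (intro order_tendstoD(2)) auto
    have ev3: "eventually (\<lambda>\<delta>. \<delta> < 1 / 2) (at_right (0::real))"
      by (rule eventually_at_right_real[of 0 "1/2", THEN eventually_mono]) auto
    show ?thesis
      using ev1 ev2 ev3 eventually_at_right_less[of 0]
    proof eventually_elim
      case (elim \<delta>)
      note \<delta> = \<open>0 < \<delta>\<close> \<open>\<delta> < 1 / 2\<close>
      have g_ev: "eventually (\<lambda>n. ereal (g n \<delta> / real n) < ereal r) sequentially"
        using elim(1) by (rule Limsup_lessD)
      \<comment> \<open>\<open>C + 1\<close> in place of \<open>C\<close> makes the inequality
        strict, so that it holds eventually, even for \<open>C = 0\<close>. The linear growth bound
        is used at \<open>2 * \<delta>\<close>, which is why \<open>\<delta> < 1 / 2\<close> is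
        required.\<close>
      have "limsup (\<lambda>n. ereal ((let k = nat \<lfloor>real n * (2 * \<delta>)\<rfloor> in if k = 0 then 0 else h k) / real n))
          < ereal ((C + 1) * (2 * \<delta>))"
        using A4[of "2 * \<delta>"] \<delta> by (rule_tac le_less_trans) auto
      then have h_ev: "eventually (\<lambda>n. ereal ((let k = nat \<lfloor>real n * (2 * \<delta>)\<rfloor> in if k = 0 then 0 else h k)
          / real n) < ereal ((C + 1) * (2 * \<delta>))) sequentially"
        by (rule Limsup_lessD)
      have "eventually (\<lambda>n. 1 / \<delta> \<le> real n) sequentially"
        by (rule eventually_sequentiallyI[of "nat \<lceil>1 / \<delta>\<rceil>"]) linarith
      with g_ev h_ev have "eventually (\<lambda>n. ereal (outer_prob M (E n \<delta>)) \<le> ereal \<eta>) sequentially"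
      proof eventually_elim
        case n: (elim n)
        define L where "L = nat \<lfloor>real n * (2 * \<delta>)\<rfloor>"
        have n\<delta>: "1 \<le> real n * \<delta>"
          using n(3) \<delta> by (simp add: field_simps)
        then have n1: "1 \<le> n"
          using \<delta> by (cases n) auto
        \<comment> \<open>Rounding \<open>2 * n * \<delta>\<close> down loses less than 1, hence
          less than \<open>n * \<delta>\<close>. This bounds the number of blocks by
          \<open>1 / \<delta> + 1\<close>, and \<open>1 \<le> L\<close> keeps clear of the
          convention for \<open>h\<close> at 0.\<close>
        have L_ge: "real n * \<delta> \<le> real L" and L1: "1 \<le> L"
          using n\<delta> unfolding L_def by linarith+
        have "Ag * (g n \<delta> / n) powr (\<nu> / 2) \<le> Ag * r powr (\<nu> / 2)"
          using n(1) nonneg n1 \<delta> nu A_nonneg by (intro mult_left_mono powr_mono2) auto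
        moreover have "real (n div L + 1) * Ah * (h L / n) powr (\<nu> / 2)
            \<le> (1 / \<delta> + 1) * Ah * (D * \<delta> powr (\<nu> / 2))"
        proof (intro mult_mono)
          have "real (n div L) \<le> real n / real L"
            by (rule of_nat_div_le_of_nat)
          also have "\<dots> \<le> 1 / \<delta>"
            using L_ge L1 \<delta> by (simp add: field_simps)
          finally show "real (n div L + 1) \<le> 1 / \<delta> + 1"
            by simp
          have "h L / n < (C + 1) * (2 * \<delta>)"
            using n(2) L1 by (simp add: Let_def flip: L_def)
          then have "h L / n \<le> 2 * (C + 1) * \<delta>"
            by (simp add: algebra_simps)
          then have "(h L / n) powr (\<nu> / 2) \<le> (2 * (C + 1) * \<delta>) powr (\<nu> / 2)"
            using nonneg[OF L1 \<delta>(1)] nu by (intro powr_mono2) auto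
          then show "(h L / n) powr (\<nu> / 2) \<le> D * \<delta> powr (\<nu> / 2)"
            using C \<delta> by (simp add: D_def powr_mult)
        qed (use A_nonneg \<delta> in auto)
        moreover have "(1 / \<delta> + 1) * Ah * (D * \<delta> powr (\<nu> / 2))
            = Ah * D * (\<delta> powr (\<nu> / 2 - 1) + \<delta> powr (\<nu> / 2))"
          using \<delta> powr_mult_base[of \<delta> "\<nu> / 2 - 1"] by (simp add: field_simps)
        ultimately show ?case
          using bound[OF n1 \<delta>(1) n\<delta> L_def] r(2) elim(2) by simp
      qed
      then show ?case
        by (rule Limsup_bounded)
    qed
  qed
  show ?thesis
    unfolding E_def[symmetric]
  proof (rule order_tendstoI)
    fix x :: ereal assume "x < 0"
    also have "0 \<le> limsup (\<lambda>n. ereal (outer_prob M (E n \<delta>)))" for \<delta>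
      by (rule le_Limsup) (auto simp: outer_prob_nonneg)
    finally show "eventually (\<lambda>\<delta>. x < limsup (\<lambda>n. ereal (outer_prob M (E n \<delta>)))) (at_right 0)"
      by simp
  next
    fix x :: ereal assume "0 < x"
    then obtain \<eta> where \<eta>: "0 < ereal \<eta>" "ereal \<eta> < x"
      using ereal_dense2 by blast
    then have "eventually (\<lambda>\<delta>. limsup (\<lambda>n. ereal (outer_prob M (E n \<delta>))) \<le> ereal \<eta>) (at_right 0)"
      by (intro small) auto
    then show "eventually (\<lambda>\<delta>. limsup (\<lambda>n. ereal (outer_prob M (E n \<delta>))) < x) (at_right 0)"
      by eventually_elim (use \<eta> in auto)
  qed
qed

section \<open>Outer expectations of Lipschitz and of continuous functionals\<close>

text \<open>\<open>outer_exp\<close> is an \<open>Inf\<close> of reals, so an upper estimate needs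
  the set of integrals to be bounded below; a lower bound on \<open>T\<close> and finiteness of the
  measure secure this.\<close>

lemma outer_exp_le:
  assumes "integrable M U" "\<And>x. x \<in> space M \<Longrightarrow> T x \<le> U x"
    and "finite_measure M" "\<And>x. x \<in> space M \<Longrightarrow> -B \<le> T x"
  shows "outer_exp M T \<le> integral\<^sup>L M U"
  unfolding outer_exp_def
proof (rule cInf_lower)
  interpret finite_measure M by fact
  show "bdd_below {integral\<^sup>L M U |U. U \<in> borel_measurable M \<and> integrable M U \<and>
      (\<forall>x\<in>space M. T x \<le> U x)}"
  proof (rule bdd_belowI)
    fix y assume "y \<in> {integral\<^sup>L M U |U. U \<in> borel_measurable M \<and> integrable M U \<and>
      (\<forall>x\<in>space M. T x \<le> U x)}"
    then obtain U where "integrable M U" "\<forall>x\<in>space M. T x \<le> U x" "y = integral\<^sup>L M U"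
      by blast
    then show "integral\<^sup>L M (\<lambda>x. - B) \<le> y"
      using assms(4) by (subst \<open>y = _\<close>, intro integral_mono) (auto intro: order_trans)
  qed
qed (use assms in auto)

lemma outer_exp_ge:
  assumes "finite_measure M" "\<And>x. x \<in> space M \<Longrightarrow> T x \<le> B"
    and "\<And>U. integrable M U \<Longrightarrow> (\<And>x. x \<in> space M \<Longrightarrow> T x \<le> U x) \<Longrightarrow> c \<le> integral\<^sup>L M U"
  shows "c \<le> outer_exp M T"
  unfolding outer_exp_def
proof (rule cInf_greatest)
  interpret finite_measure M by fact
  have "integral\<^sup>L M (\<lambda>x. B) \<in> {integral\<^sup>L M U |U. U \<in> borel_measurable M \<and> integrable M U \<and>
      (\<forall>x\<in>space M. T x \<le> U x)}"
    using assms(2) by (intro CollectI exI[of _ "\<lambda>x. B"]) auto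
  then show "{integral\<^sup>L M U |U. U \<in> borel_measurable M \<and> integrable M U \<and>
      (\<forall>x\<in>space M. T x \<le> U x)} \<noteq> {}"
    by blast
qed (use assms(3) in auto)

lemma outer_exp_mono:
  assumes "finite_measure M"
    and "\<And>x. x \<in> space M \<Longrightarrow> -B \<le> T x" "\<And>x. x \<in> space M \<Longrightarrow> T x \<le> T' x"
    and "\<And>x. x \<in> space M \<Longrightarrow> T' x \<le> B'"
  shows "outer_exp M T \<le> outer_exp M T'"
proof (rule outer_exp_ge[OF assms(1,4)])
  fix U assume "integrable M U" "\<And>x. x \<in> space M \<Longrightarrow> T' x \<le> U x"
  then show "outer_exp M T \<le> integral\<^sup>L M U"
    using assms by (intro outer_exp_le[of M _ T B]) (meson order_trans)+
qed

text \<open>\<open>T\<close> is squeezed between the integrable functions \<open>V - W\<close> and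
  \<open>V + W\<close>, where \<open>W\<close> is the error bound. In the application
  \<open>A\<close> covers the event of a large discretisation error.\<close>

lemma outer_exp_close:
  assumes "prob_space M" and V: "integrable M V" and A: "A \<in> sets M"
    and bdd: "\<And>x. x \<in> space M \<Longrightarrow> \<bar>T x\<bar> \<le> B"
    and close: "\<And>x. x \<in> space M \<Longrightarrow> \<bar>T x - V x\<bar> \<le> a + b * indicator A x"
  shows "\<bar>outer_exp M T - integral\<^sup>L M V\<bar> \<le> a + b * measure M A"
proof -
  interpret prob_space M by fact
  define W where "W = (\<lambda>x. a + b * indicator A x :: real)"
  have W: "integrable M W" "integral\<^sup>L M W = a + b * measure M A"
    using A by (auto simp: W_def prob_space emeasure_eq_measure)
  have T: "- B \<le> T x" "T x \<le> B" if "x \<in> space M" for x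
    using bdd[OF that] by linarith+
  have TV: "V x - W x \<le> T x" "T x \<le> V x + W x" if "x \<in> space M" for x
    using close[OF that] unfolding W_def abs_le_iff by linarith+
  have "outer_exp M T \<le> integral\<^sup>L M (\<lambda>x. V x + W x)"
    using V W TV T finite_measure_axioms by (intro outer_exp_le[of _ _ _ B]) auto
  moreover have "integral\<^sup>L M (\<lambda>x. V x - W x) \<le> outer_exp M T"
  proof (rule outer_exp_ge[of _ _ B])
    fix U assume U: "integrable M U" "\<And>x. x \<in> space M \<Longrightarrow> T x \<le> U x"
    show "integral\<^sup>L M (\<lambda>x. V x - W x) \<le> integral\<^sup>L M U"
      using U V W TV by (intro integral_mono) (auto intro: order_trans)
  qed (use T finite_measure_axioms in auto)
  ultimately show ?thesis
    using V W by (simp add: abs_le_iff)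
qed

lemma measurable_continuous_map_borel_of:
  assumes G: "continuous_map \<X> euclideanreal G" and Z: "Z \<in> measurable N (borel_of \<X>)"
  shows "(\<lambda>v. G (Z v)) \<in> borel_measurable N"
proof -
  have sub: "{U. openin \<X> U} \<subseteq> Pow (topspace \<X>)"
    using openin_subset by auto
  have "G \<in> borel_measurable (borel_of \<X>)"
  proof (rule borel_measurableI)
    fix S :: "real set" assume "open S"
    then have "openin \<X> {x \<in> topspace \<X>. G x \<in> S}"
      by (intro openin_continuous_map_preimage[OF G]) (simp add: \<open>open S\<close>)
    moreover have "G -` S \<inter> space (borel_of \<X>) = {x \<in> topspace \<X>. G x \<in> S}"
      using sub by (auto simp: borel_of_def)
    ultimately show "G -` S \<inter> space (borel_of \<X>) \<in> sets (borel_of \<X>)"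
      using sub by (simp add: borel_of_def sets_measure_of)
  qed
  from measurable_compose[OF Z this] show ?thesis .
qed

lemma closedin_sets_borel_of:
  assumes "closedin \<X> K"
  shows "K \<in> sets (borel_of \<X>)"
proof -
  have sub: "{U. openin \<X> U} \<subseteq> Pow (topspace \<X>)"
    using openin_subset by auto
  have "topspace \<X> - K \<in> sets (borel_of \<X>)"
    using assms sub by (auto simp: borel_of_def sets_measure_of closedin_def)
  moreover have "space (borel_of \<X>) = topspace \<X>"
    using sub by (simp add: borel_of_def space_measure_of)
  moreover have "K \<subseteq> topspace \<X>"
    using assms by (rule closedin_subset)
  ultimately show ?thesis
    using sets.compl_sets[of "topspace \<X> - K" "borel_of \<X>"] by (simp add: double_diff)
qed

lemma continuous_map_Lipschitz:
  assumes "\<And>x y. x \<in> mspace m \<Longrightarrow> y \<in> mspace m \<Longrightarrow> \<bar>G x - G y\<bar> \<le> L * mdist m x y"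
  shows "continuous_map (mtopology_of m) euclideanreal G"
proof -
  have "Lipschitz_continuous_map m euclidean_metric G"
    unfolding Lipschitz_continuous_map_def using assms by (auto simp: dist_real_def)
  from Lipschitz_continuous_imp_continuous_map[OF this] show ?thesis
    by simp
qed

section \<open>Reduction from continuous to Lipschitz functionals\<close>

text \<open>This is the Pasch-Hausdorff envelope, the infimal convolution of \<open>H\<close> with
  \<open>k\<close> times the distance; for bounded \<open>H\<close> and \<open>k \<ge> 0\<close> it
  is the largest \<open>k\<close>-Lipschitz function below \<open>H\<close>.\<close>

definition lipschitz_minorant :: "'z metric \<Rightarrow> ('z \<Rightarrow> real) \<Rightarrow> real \<Rightarrow> 'z \<Rightarrow> real" where
  "lipschitz_minorant m H k x = (INF y\<in>mspace m. H y + k * mdist m x y)"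

context
  fixes m :: "'z metric" and H :: "'z \<Rightarrow> real" and B :: real
  assumes bdd: "\<And>z. z \<in> mspace m \<Longrightarrow> \<bar>H z\<bar> \<le> B"
begin

lemma lipschitz_minorant_bdd_below:
  assumes "0 \<le> k"
  shows "bdd_below ((\<lambda>y. H y + k * mdist m x y) ` mspace m)"
proof (rule bdd_belowI2)
  show "- B \<le> H y + k * mdist m x y" if "y \<in> mspace m" for y
    using bdd[OF that] assms mult_nonneg_nonneg[OF assms mdist_nonneg[of m x y]] by linarith
qed

lemma lipschitz_minorant_le:
  assumes "0 \<le> k" "x \<in> mspace m"
  shows "lipschitz_minorant m H k x \<le> H x"
proof -
  have zero: "mdist m x x = 0"
    using assms by simp
  show ?thesis
    using cINF_lower[OF lipschitz_minorant_bdd_below[OF assms(1)] assms(2), of x] assms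
    by (simp add: lipschitz_minorant_def zero)
qed

lemma lipschitz_minorant_ge:
  assumes "0 \<le> k" "x \<in> mspace m"
  shows "- B \<le> lipschitz_minorant m H k x"
  unfolding lipschitz_minorant_def
proof (rule cINF_greatest)
  show "- B \<le> H y + k * mdist m x y" if "y \<in> mspace m" for y
    using bdd[OF that] assms mult_nonneg_nonneg[OF assms(1) mdist_nonneg[of m x y]] by linarith
qed (use assms in auto)

lemma lipschitz_minorant_lipschitz:
  assumes "0 \<le> k" "x \<in> mspace m" "x' \<in> mspace m"
  shows "\<bar>lipschitz_minorant m H k x - lipschitz_minorant m H k x'\<bar> \<le> k * mdist m x x'"
proof -
  have "lipschitz_minorant m H k x - k * mdist m x x' \<le> lipschitz_minorant m H k x'"
    if xx: "x \<in> mspace m" "x' \<in> mspace m" for x x'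
    unfolding lipschitz_minorant_def[of _ _ _ x']
  proof (rule cINF_greatest)
    fix y assume y: "y \<in> mspace m"
    have "lipschitz_minorant m H k x \<le> H y + k * mdist m x y"
      unfolding lipschitz_minorant_def by (rule cINF_lower[OF lipschitz_minorant_bdd_below[OF assms(1)] y])
    also have "k * mdist m x y \<le> k * (mdist m x x' + mdist m x' y)"
      using xx y assms by (intro mult_left_mono mdist_triangle) auto
    finally show "lipschitz_minorant m H k x - k * mdist m x x' \<le> H y + k * mdist m x' y"
      by (simp add: algebra_simps)
  qed (use xx in auto)
  from this[OF assms(2,3)] this[OF assms(3,2)] show ?thesis
    by (simp add: abs_le_iff mdist_commute)
qed

text \<open>Points near \<open>x\<close> lower the infimum by at most \<open>e / 2\<close>, by
  continuity at \<open>x\<close>. Points at distance at least \<open>d\<close> pay the penalty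
  \<open>k * d\<close>, which exceeds the oscillation \<open>2 * B\<close> for large
  \<open>k\<close>. Pointwise convergence is enough later.\<close>

lemma lipschitz_minorant_tendsto:
  assumes cont: "continuous_map (mtopology_of m) euclideanreal H" and x: "x \<in> mspace m"
  shows "(\<lambda>k. lipschitz_minorant m H (real k) x) \<longlonglongrightarrow> H x"
proof (rule LIMSEQ_I)
  fix e :: real assume e: "0 < e"
  interpret Metric_space "mspace m" "mdist m"
    by (rule Metric_space_mspace_mdist)
  have "continuous_map mtopology Met_TC.mtopology H"
    using cont by (simp add: mtopology_of_def)
  then have "\<exists>d>0. \<forall>y. y \<in> mspace m \<and> mdist m x y < d \<longrightarrow> dist (H x) (H y) < e / 2"
    unfolding metric_continuous_map[OF Met_TC.Metric_space_axioms]
    using x half_gt_zero[OF e] by blast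
  then obtain d where d: "d > 0" "\<And>y. y \<in> mspace m \<Longrightarrow> mdist m x y < d \<Longrightarrow> \<bar>H x - H y\<bar> < e / 2"
    unfolding dist_real_def by blast
  have B0: "0 \<le> B"
    using bdd[OF x] by linarith
  obtain k0 :: nat where k0: "2 * B / d \<le> real k0"
    using real_arch_simple by blast
  have "\<bar>lipschitz_minorant m H (real k) x - H x\<bar> < e" if k: "k0 \<le> k" for k
  proof -
    have "H x - e / 2 \<le> lipschitz_minorant m H (real k) x"
      unfolding lipschitz_minorant_def
    proof (rule cINF_greatest)
      fix y assume y: "y \<in> mspace m"
      have nn: "0 \<le> real k * mdist m x y"
        by simp
      show "H x - e / 2 \<le> H y + real k * mdist m x y"
      proof (cases "mdist m x y < d")
        case True
        then show ?thesis
          using d(2)[OF y] nn by linarith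
      next
        case False
        have "2 * B \<le> real k0 * d"
          using k0 d by (simp add: field_simps)
        also have "\<dots> \<le> real k * mdist m x y"
          using False k d by (intro mult_mono) auto
        finally show ?thesis
          using bdd[OF x] bdd[OF y] e by linarith
      qed
    qed (use x in auto)
    then show ?thesis
      using lipschitz_minorant_le[of "real k" x] x e by simp
  qed
  then show "\<exists>no. \<forall>k\<ge>no. norm (lipschitz_minorant m H (real k) x - H x) < e"
    by (auto simp: real_norm_def)
qed

end

text \<open>Lipschitz minorants of \<open>H\<close> bound the outer expectations asymptotically from
  below; negated minorants of \<open>- H\<close> bound them from above. Dominated convergence is
  used only for the measurable limit \<open>Z\<close>; for \<open>Zn\<close> monotonicity of the
  outer expectation suffices.\<close>

lemma outer_exp_tendsto_of_Lipschitz: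
  fixes m :: "'z metric"
  assumes M: "finite_measure M" and N: "finite_measure N"
    and Zn: "\<And>n \<omega>. \<omega> \<in> space M \<Longrightarrow> Zn n \<omega> \<in> mspace m"
    and Z: "Z \<in> measurable N (borel_of (mtopology_of m))"
    and lip: "\<And>G L B. 0 \<le> L \<Longrightarrow> (\<And>z. z \<in> mspace m \<Longrightarrow> \<bar>G z\<bar> \<le> B) \<Longrightarrow>
      (\<And>x y. x \<in> mspace m \<Longrightarrow> y \<in> mspace m \<Longrightarrow> \<bar>G x - G y\<bar> \<le> L * mdist m x y) \<Longrightarrow>
      (\<lambda>n. outer_exp M (\<lambda>\<omega>. G (Zn n \<omega>))) \<longlonglongrightarrow> integral\<^sup>L N (\<lambda>v. G (Z v))"
    and H: "continuous_map (mtopology_of m) euclideanreal H"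
    and bdd: "\<And>z. z \<in> mspace m \<Longrightarrow> \<bar>H z\<bar> \<le> B"
  shows "(\<lambda>n. outer_exp M (\<lambda>\<omega>. H (Zn n \<omega>))) \<longlonglongrightarrow> integral\<^sup>L N (\<lambda>v. H (Z v))"
proof (rule order_tendstoI)
  interpret N: finite_measure N by fact
  have Zin: "Z v \<in> mspace m" if "v \<in> space N" for v
    using measurable_space[OF Z that] by (auto simp: borel_of_def space_measure_of_conv)
  have conv: "(\<lambda>k. integral\<^sup>L N (\<lambda>v. lipschitz_minorant m H' (real k) (Z v))) \<longlonglongrightarrow> integral\<^sup>L N (\<lambda>v. H' (Z v))"
    if H': "continuous_map (mtopology_of m) euclideanreal H'" "\<And>z. z \<in> mspace m \<Longrightarrow> \<bar>H' z\<bar> \<le> B" for H'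
  proof (rule integral_dominated_convergence[where w = "\<lambda>_. B"])
    show "(\<lambda>v. H' (Z v)) \<in> borel_measurable N"
      by (rule measurable_continuous_map_borel_of[OF H'(1) Z])
    show "(\<lambda>v. lipschitz_minorant m H' (real k) (Z v)) \<in> borel_measurable N" for k
      by (rule measurable_continuous_map_borel_of[OF _ Z], rule continuous_map_Lipschitz,
          rule lipschitz_minorant_lipschitz[OF H'(2)]) auto
    show "AE v in N. (\<lambda>k. lipschitz_minorant m H' (real k) (Z v)) \<longlonglongrightarrow> H' (Z v)"
      using Zin by (intro AE_I2 lipschitz_minorant_tendsto[OF H'(2) H'(1)])
    show "AE v in N. norm (lipschitz_minorant m H' (real k) (Z v)) \<le> B" for k
    proof (rule AE_I2)
      fix v assume "v \<in> space N"
      then show "norm (lipschitz_minorant m H' (real k) (Z v)) \<le> B"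
        using lipschitz_minorant_ge[where m = m and H = H', OF H'(2), where k = "real k" and x = "Z v"]
          lipschitz_minorant_le[where m = m and H = H', OF H'(2), where k = "real k" and x = "Z v"] H'(2)[of "Z v"] Zin[of v] by auto
    qed
  qed simp
  fix a
  { assume a: "a < integral\<^sup>L N (\<lambda>v. H (Z v))"
    have "eventually (\<lambda>k. a < integral\<^sup>L N (\<lambda>v. lipschitz_minorant m H (real k) (Z v))) sequentially"
      using conv[OF H bdd] a by (rule order_tendstoD)
    then obtain k where k: "a < integral\<^sup>L N (\<lambda>v. lipschitz_minorant m H (real k) (Z v))"
      by (auto simp: eventually_sequentially)
    define G where "G = lipschitz_minorant m H (real k)"
    have G: "- B \<le> G z" "G z \<le> H z" if "z \<in> mspace m" for z
      using lipschitz_minorant_ge[OF bdd, where k = "real k" and x = z] lipschitz_minorant_le[OF bdd, where k = "real k" and x = z] that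
      by (auto simp: G_def)
    have "\<bar>G z\<bar> \<le> B" if "z \<in> mspace m" for z
      using G[OF that] bdd[OF that] by auto
    moreover have "\<bar>G x - G y\<bar> \<le> real k * mdist m x y" if "x \<in> mspace m" "y \<in> mspace m" for x y
      unfolding G_def using that by (intro lipschitz_minorant_lipschitz[OF bdd]) auto
    ultimately have "(\<lambda>n. outer_exp M (\<lambda>\<omega>. G (Zn n \<omega>))) \<longlonglongrightarrow> integral\<^sup>L N (\<lambda>v. G (Z v))"
      by (intro lip[of "real k"]) auto
    then have "eventually (\<lambda>n. a < outer_exp M (\<lambda>\<omega>. G (Zn n \<omega>))) sequentially"
      using k unfolding G_def by (rule order_tendstoD)
    moreover have "outer_exp M (\<lambda>\<omega>. G (Zn n \<omega>)) \<le> outer_exp M (\<lambda>\<omega>. H (Zn n \<omega>))" for n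
      using Zn G abs_le_D1[OF bdd] by (intro outer_exp_mono[OF M, of B _ _ B]) auto
    ultimately show "eventually (\<lambda>n. a < outer_exp M (\<lambda>\<omega>. H (Zn n \<omega>))) sequentially"
      by (elim eventually_mono) (rule less_le_trans) }
  { assume a: "integral\<^sup>L N (\<lambda>v. H (Z v)) < a"
    have H': "continuous_map (mtopology_of m) euclideanreal (\<lambda>z. - H z)"
      using H by (rule continuous_map_minus)
    have bdd': "\<bar>- H z\<bar> \<le> B" if "z \<in> mspace m" for z
      using bdd[OF that] by simp
    have lower: "- B \<le> H z" if "z \<in> mspace m" for z
      using bdd[OF that] by linarith
    have "- a < integral\<^sup>L N (\<lambda>v. - H (Z v))"
      using a by simp
    moreover have "(\<lambda>k. integral\<^sup>L N (\<lambda>v. lipschitz_minorant m (\<lambda>z. - H z) (real k) (Z v)))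
        \<longlonglongrightarrow> integral\<^sup>L N (\<lambda>v. - H (Z v))"
      using H' bdd' by (rule conv)
    ultimately have "eventually (\<lambda>k. - a < integral\<^sup>L N (\<lambda>v. lipschitz_minorant m (\<lambda>z. - H z) (real k) (Z v))) sequentially"
      by (metis order_tendstoD(1))
    then obtain k where k: "- a < integral\<^sup>L N (\<lambda>v. lipschitz_minorant m (\<lambda>z. - H z) (real k) (Z v))"
      by (auto simp: eventually_sequentially)
    define G where "G = (\<lambda>z. - lipschitz_minorant m (\<lambda>z. - H z) (real k) z)"
    have G: "G z \<le> B" "H z \<le> G z" if "z \<in> mspace m" for z
      using lipschitz_minorant_ge[where m = m and H = "\<lambda>z. - H z", OF bdd', where k = "real k" and x = z] lipschitz_minorant_le[where m = m and H = "\<lambda>z. - H z", OF bdd', where k = "real k" and x = z] that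
      by (auto simp: G_def)
    have "\<bar>G z\<bar> \<le> B" if "z \<in> mspace m" for z
      using G[OF that] bdd[OF that] by auto
    moreover have "\<bar>G x - G y\<bar> \<le> real k * mdist m x y" if "x \<in> mspace m" "y \<in> mspace m" for x y
      using lipschitz_minorant_lipschitz[where m = m and H = "\<lambda>z. - H z", OF bdd', where k = "real k" and x = x and x' = y] that by (simp add: G_def)
    ultimately have "(\<lambda>n. outer_exp M (\<lambda>\<omega>. G (Zn n \<omega>))) \<longlonglongrightarrow> integral\<^sup>L N (\<lambda>v. G (Z v))"
      by (intro lip[of "real k"]) auto
    moreover have "integral\<^sup>L N (\<lambda>v. G (Z v)) < a"
      using k by (simp add: G_def)
    ultimately have "eventually (\<lambda>n. outer_exp M (\<lambda>\<omega>. G (Zn n \<omega>)) < a) sequentially"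
      by (rule order_tendstoD)
    moreover have "outer_exp M (\<lambda>\<omega>. H (Zn n \<omega>)) \<le> outer_exp M (\<lambda>\<omega>. G (Zn n \<omega>))" for n
      using Zn G lower by (intro outer_exp_mono[OF M, of B _ _ B]) auto
    ultimately show "eventually (\<lambda>n. outer_exp M (\<lambda>\<omega>. H (Zn n \<omega>)) < a) sequentially"
      by (elim eventually_mono) (rule le_less_trans) }
qed

section \<open>Bounded functions and finitely many coordinates\<close>

lemma mem_linf_iff:
  "z \<in> mspace (funspace T (euclidean_metric :: real metric)) \<longleftrightarrow>
     z \<in> extensional T \<and> (\<exists>B. \<forall>t\<in>T. \<bar>z t\<bar> \<le> B)"
proof -
  have "Met_TC.mbounded (z ` T) \<longleftrightarrow> (\<exists>B. \<forall>t\<in>T. \<bar>z t\<bar> \<le> B)"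
    by (auto simp: bounded_iff)
  then show ?thesis
    by (simp add: Met_TC.fspace_def)
qed

lemma mdist_linf_le:
  fixes z z' :: "'t \<Rightarrow> real"
  assumes "0 \<le> c" "\<And>t. t \<in> T \<Longrightarrow> \<bar>z t - z' t\<bar> \<le> c"
  shows "mdist (funspace T euclidean_metric) z z' \<le> c"
  using assms by (auto simp: Met_TC.fdist_def dist_real_def intro!: cSUP_least)

lemma abs_diff_le_mdist_linf:
  fixes z z' :: "'t \<Rightarrow> real"
  assumes "z \<in> mspace (funspace T euclidean_metric)" "z' \<in> mspace (funspace T euclidean_metric)" "t \<in> T"
  shows "\<bar>z t - z' t\<bar> \<le> mdist (funspace T euclidean_metric) z z'"
proof -
  have "dist (z t) (z' t) \<le> (SUP t\<in>T. dist (z t) (z' t))"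
    using assms by (intro cSUP_upper Met_TC.bdd_above_dist[of z T z']) auto
  then show ?thesis
    using assms by (auto simp: Met_TC.fdist_def dist_real_def)
qed

lemma borel_measurable_finitely_many_coordinates:
  fixes \<Psi> :: "('t \<Rightarrow> real) \<Rightarrow> real"
  assumes S: "finite S" and \<Psi>: "continuous_on (extensional S) \<Psi>"
    and Y: "\<And>s. s \<in> S \<Longrightarrow> (\<lambda>\<omega>. Y \<omega> s) \<in> borel_measurable M"
  shows "(\<lambda>\<omega>. \<Psi> (restrict (Y \<omega>) S)) \<in> borel_measurable M"
proof -
  \<comment> \<open>The index type \<open>'t\<close> may be uncountable, where coordinatewise
    measurability does not give Borel measurability for the product topology. Numbering the finitely
    many relevant coordinates moves the argument to functions on \<open>nat\<close>; 0 fills the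
    other positions.\<close>
  define \<Psi>' where "\<Psi>' = (\<lambda>w :: nat \<Rightarrow> real. \<Psi> (\<lambda>s\<in>S. w (to_nat_on S s)))"
  define W where "W = (\<lambda>\<omega> i. if i \<in> to_nat_on S ` S then Y \<omega> (from_nat_into S i) else 0)"
  have "continuous_on UNIV (\<lambda>w :: nat \<Rightarrow> real. \<lambda>s\<in>S. w (to_nat_on S s))"
  proof (rule continuous_on_coordinatewise_then_product)
    fix s
    show "continuous_on UNIV (\<lambda>w :: nat \<Rightarrow> real. (\<lambda>s\<in>S. w (to_nat_on S s)) s)"
      by (cases "s \<in> S") (auto intro!: continuous_intros)
  qed
  then have "continuous_on UNIV \<Psi>'"
    unfolding \<Psi>'_def by (intro continuous_on_compose2[OF \<Psi>]) auto
  then have "\<Psi>' \<in> borel_measurable borel"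
    by (rule borel_measurable_continuous_onI)
  moreover have "W \<in> borel_measurable M"
  proof (rule measurable_coordinatewise_then_product)
    show "(\<lambda>\<omega>. W \<omega> i) \<in> borel_measurable M" for i
      using Y countable_finite[OF S] by (cases "i \<in> to_nat_on S ` S") (auto simp: W_def)
  qed
  ultimately have "(\<lambda>\<omega>. \<Psi>' (W \<omega>)) \<in> borel_measurable M"
    by (rule measurable_compose[rotated])
  also have "(\<lambda>\<omega>. \<Psi>' (W \<omega>)) = (\<lambda>\<omega>. \<Psi> (restrict (Y \<omega>) S))"
    using S by (auto simp: \<Psi>'_def W_def countable_finite intro!: ext arg_cong[of _ _ \<Psi>] restrict_ext)
  finally show ?thesis .
qed

lemma continuous_on_coordinate: "continuous_on A (\<lambda>u :: 't \<Rightarrow> real. u t)"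
  by (rule continuous_on_subset[OF continuous_on_product_coordinates]) simp

text \<open>A finite sum of coordinate differences is continuous in the product topology, so a
  Lipschitz bound by such a sum gives continuity there, although the uniform distance is not
  continuous in that topology.\<close>

lemma continuous_on_finitely_many_coordinates:
  fixes \<Psi> :: "('t \<Rightarrow> real) \<Rightarrow> real"
  assumes S: "finite S"
    and lip: "\<And>u v. u \<in> A \<Longrightarrow> v \<in> A \<Longrightarrow> \<bar>\<Psi> u - \<Psi> v\<bar> \<le> L * (\<Sum>s\<in>S. \<bar>u s - v s\<bar>)"
  shows "continuous_on A \<Psi>"
  unfolding continuous_on_def
proof
  fix u assume u: "u \<in> A"
  have "continuous_on A (\<lambda>v. L * (\<Sum>s\<in>S. \<bar>v s - u s\<bar>))"
    by (intro continuous_intros continuous_on_coordinate)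
  then have "((\<lambda>v. L * (\<Sum>s\<in>S. \<bar>v s - u s\<bar>)) \<longlongrightarrow> L * (\<Sum>s\<in>S. \<bar>u s - u s\<bar>)) (at u within A)"
    using u unfolding continuous_on_def by blast
  then have "((\<lambda>v. L * (\<Sum>s\<in>S. \<bar>v s - u s\<bar>)) \<longlongrightarrow> 0) (at u within A)"
    by simp
  moreover have "eventually (\<lambda>v. dist (\<Psi> v) (\<Psi> u) \<le> dist (L * (\<Sum>s\<in>S. \<bar>v s - u s\<bar>)) 0) (at u within A)"
    unfolding eventually_at_topological
  proof (intro exI[of _ UNIV] conjI ballI impI)
    fix v assume "v \<in> A"
    then show "dist (\<Psi> v) (\<Psi> u) \<le> dist (L * (\<Sum>s\<in>S. \<bar>v s - u s\<bar>)) 0"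
      using lip[of v u] u by (simp add: dist_real_def)
  qed auto
  ultimately show "(\<Psi> \<longlongrightarrow> \<Psi> u) (at u within A)"
    by (rule metric_tendsto_imp_tendsto)
qed

lemma compactin_finite_net:
  assumes "compactin (mtopology_of m) K" "0 < e"
  obtains J where "finite J" "J \<subseteq> K" "\<And>z. z \<in> K \<Longrightarrow> \<exists>z'\<in>J. mdist m z' z < e"
proof -
  interpret Metric_space "mspace m" "mdist m"
    by (rule Metric_space_mspace_mdist)
  have "mtotally_bounded K"
    using assms by (intro compactin_imp_mtotally_bounded) (simp add: mtopology_of_def)
  from this[unfolded mtotally_bounded_def, rule_format, OF assms(2)]
  obtain J where J: "finite J" "J \<subseteq> K" "K \<subseteq> (\<Union>x\<in>J. mball x e)"
    by blast
  show ?thesis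
    by (rule that[OF J(1,2)]) (use J(3) in \<open>auto simp: subset_iff\<close>)
qed

text \<open>A compact set of bounded functions is approximated by finitely many of them, so on it a
  uniformly small discretisation error is detected by finitely many of the coordinates.\<close>
lemma compactin_linf_finite_test_set:
  fixes T :: "'t set" and K :: "('t \<Rightarrow> real) set"
  assumes K: "compactin (mtopology_of (funspace T euclidean_metric)) K" and e: "0 < e"
    and \<pi>: "\<And>t. t \<in> T \<Longrightarrow> \<pi> t \<in> T"
  obtains J where "finite J" "J \<subseteq> T"
    "\<And>z. z \<in> K \<Longrightarrow> (\<And>t. t \<in> J \<Longrightarrow> \<bar>z t - z (\<pi> t)\<bar> \<le> 2 * e) \<Longrightarrow> (\<And>t. t \<in> T \<Longrightarrow> \<bar>z t - z (\<pi> t)\<bar> \<le> 6 * e)"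
proof -
  let ?m = "funspace T (euclidean_metric :: real metric)"
  obtain J0 where J0: "finite J0" "J0 \<subseteq> K" "\<And>z. z \<in> K \<Longrightarrow> \<exists>z'\<in>J0. mdist ?m z' z < e"
    using compactin_finite_net[OF K e] by blast
  have KM: "K \<subseteq> mspace ?m"
    using compactin_subset_topspace[OF K] by simp
  \<comment> \<open>Each net point with error above \<open>4 * e\<close> contributes one witness
    coordinate. A function within \<open>e\<close> of it still has error above \<open>2 * e\<close>
    at the witness, so passing the test excludes such net points. All other net points have error at
    most \<open>4 * e\<close>, and moving to \<open>z\<close> adds at most
    \<open>2 * e\<close>.\<close>
  define J1 where "J1 = {z \<in> J0. \<exists>t\<in>T. 4 * e < \<bar>z t - z (\<pi> t)\<bar>}"
  have "\<forall>z\<in>J1. \<exists>t\<in>T. 4 * e < \<bar>z t - z (\<pi> t)\<bar>"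
    by (auto simp: J1_def)
  then obtain w where w: "\<And>z. z \<in> J1 \<Longrightarrow> w z \<in> T \<and> 4 * e < \<bar>z (w z) - z (\<pi> (w z))\<bar>"
    by metis
  show ?thesis
  proof (rule that[of "w ` J1"])
    show "finite (w ` J1)" "w ` J1 \<subseteq> T"
      using J0 w by (auto simp: J1_def)
    fix z t assume z: "z \<in> K" and small: "\<And>t. t \<in> w ` J1 \<Longrightarrow> \<bar>z t - z (\<pi> t)\<bar> \<le> 2 * e" and t: "t \<in> T"
    obtain z' where z': "z' \<in> J0" "mdist ?m z' z < e"
      using J0(3)[OF z] by blast
    then have near: "\<bar>z' s - z s\<bar> < e" if "s \<in> T" for s
      using abs_diff_le_mdist_linf[of z' T z s] KM J0(2) z that by force
    show "\<bar>z t - z (\<pi> t)\<bar> \<le> 6 * e"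
    proof (cases "z' \<in> J1")
      case True
      then have "\<bar>z (w z') - z (\<pi> (w z'))\<bar> \<le> 2 * e"
        by (intro small) auto
      then show ?thesis
        using w[OF True] near[of "w z'"] near[of "\<pi> (w z')"] \<pi>[of "w z'"] by linarith
    next
      case False
      then have "\<bar>z' t - z' (\<pi> t)\<bar> \<le> 4 * e"
        using z' t by (force simp: J1_def)
      then show ?thesis
        using near[OF t] near[OF \<pi>[OF t]] by linarith
    qed
  qed
qed

section \<open>Comparison through a finite net\<close>

text \<open>A three-term comparison: \<open>G\<close> with its discretisation \<open>\<Psi>\<close>
  along \<open>Zn\<close>, \<open>\<Psi>\<close> along \<open>Zn\<close> with \<open>\<Psi>\<close>
  along \<open>Z\<close> by the marginals, and \<open>\<Psi>\<close> with \<open>G\<close> along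
  \<open>Z\<close>. Only the last term needs tightness.\<close>

lemma outer_exp_tendsto_of_discretisation:
  fixes T :: "'t set" and Zn :: "nat \<Rightarrow> 'w \<Rightarrow> 't \<Rightarrow> real" and Z :: "'v \<Rightarrow> 't \<Rightarrow> real"
  defines "m \<equiv> funspace T (euclidean_metric :: real metric)"
  assumes M: "prob_space M" and N: "prob_space N"
    and Zn: "\<And>n \<omega>. \<omega> \<in> space M \<Longrightarrow> Zn n \<omega> \<in> mspace m"
    and Zn_meas: "\<And>n t. t \<in> T \<Longrightarrow> (\<lambda>\<omega>. Zn n \<omega> t) \<in> borel_measurable M"
    and Z: "Z \<in> measurable N (borel_of (mtopology_of m))"
    and tight: "\<And>e. 0 < e \<Longrightarrow> \<exists>K. compactin (mtopology_of m) K \<and> measure N (Z -` K \<inter> space N) \<ge> 1 - e"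
    and fidi: "\<And>S (\<phi> :: ('t \<Rightarrow> real) \<Rightarrow> real). finite S \<Longrightarrow> S \<subseteq> T \<Longrightarrow> continuous_on (extensional S) \<phi> \<Longrightarrow>
        \<exists>B. \<forall>u \<in> extensional S. \<bar>\<phi> u\<bar> \<le> B \<Longrightarrow>
        (\<lambda>n. integral\<^sup>L M (\<lambda>\<omega>. \<phi> (restrict (Zn n \<omega>) S)))
          \<longlonglongrightarrow> integral\<^sup>L N (\<lambda>v. \<phi> (restrict (Z v) S))"
    and discr: "\<And>e \<eta>. 0 < e \<Longrightarrow> 0 < \<eta> \<Longrightarrow> \<exists>\<pi> S. finite S \<and> S \<subseteq> T \<and> (\<forall>t\<in>T. \<pi> t \<in> S) \<and>
        eventually (\<lambda>n. outer_prob M {\<omega> \<in> space M. \<exists>t\<in>T. e < \<bar>Zn n \<omega> t - Zn n \<omega> (\<pi> t)\<bar>} < \<eta>) sequentially"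
    and L: "0 \<le> L" and bdd: "\<And>z. z \<in> mspace m \<Longrightarrow> \<bar>G z\<bar> \<le> B"
    and lip: "\<And>x y. x \<in> mspace m \<Longrightarrow> y \<in> mspace m \<Longrightarrow> \<bar>G x - G y\<bar> \<le> L * mdist m x y"
  shows "(\<lambda>n. outer_exp M (\<lambda>\<omega>. G (Zn n \<omega>))) \<longlonglongrightarrow> integral\<^sup>L N (\<lambda>v. G (Z v))"
proof (rule tendstoI)
  interpret M: prob_space M by fact
  interpret N: prob_space N by fact
  have Zin: "Z v \<in> mspace m" if "v \<in> space N" for v
    using measurable_space[OF Z that] by (auto simp: borel_of_def space_measure_of_conv)
  have B0: "0 \<le> B"
  proof -
    obtain v where "v \<in> space N"
      using N.not_empty by blast
    then show ?thesis
      using bdd[OF Zin] by (meson abs_ge_zero order_trans)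
  qed
  have coord: "continuous_map (mtopology_of m) euclideanreal (\<lambda>z. z t)" if "t \<in> T" for t
    using that abs_diff_le_mdist_linf[of _ T _ t]
    by (intro continuous_map_Lipschitz[of _ _ 1]) (auto simp: m_def)
  have Z_meas: "(\<lambda>v. Z v t) \<in> borel_measurable N" if "t \<in> T" for t
    using coord[OF that] Z by (rule measurable_continuous_map_borel_of)
  have GZ_meas: "(\<lambda>v. G (Z v)) \<in> borel_measurable N"
    using continuous_map_Lipschitz[OF lip] Z by (rule measurable_continuous_map_borel_of)
  fix x :: real assume x: "0 < x"
  \<comment> \<open>The Lipschitz errors add up to \<open>7 * (L * e)\<close>, one for
    \<open>Zn\<close> and six for \<open>Z\<close>. The exceptional events cost
    \<open>2 * B * \<kappa>\<close> for \<open>Zn\<close> and \<open>4 * B * \<kappa>\<close> for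
    \<open>Z\<close>, and the marginals one more \<open>\<kappa>\<close>. Adding 1 to
    \<open>L\<close> and to \<open>6 * B\<close> avoids division by zero.\<close>
  define e \<kappa> where "e = x / (14 * (L + 1))" and "\<kappa> = x / (4 * (6 * B + 1))"
  have e: "0 < e" and \<kappa>: "0 < \<kappa>"
    using x L B0 by (auto simp: e_def \<kappa>_def)
  have budget: "7 * (L * e) + (6 * B + 1) * \<kappa> < x"
  proof -
    have "7 * (L * e) \<le> 7 * ((L + 1) * e)"
      using e by (simp add: algebra_simps)
    also have "7 * ((L + 1) * e) = x / 2"
      using L by (simp add: e_def field_simps)
    moreover have "(6 * B + 1) * \<kappa> = x / 4"
      using B0 by (simp add: \<kappa>_def field_simps)
    ultimately show ?thesis
      using x by linarith
  qed
  obtain K where K: "compactin (mtopology_of m) K" "measure N (Z -` K \<inter> space N) \<ge> 1 - \<kappa>"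
    using tight[OF \<kappa>] by blast
  obtain \<pi> S where S: "finite S" "S \<subseteq> T" and \<pi>: "\<And>t. t \<in> T \<Longrightarrow> \<pi> t \<in> S"
    and ev: "eventually (\<lambda>n. outer_prob M {\<omega> \<in> space M. \<exists>t\<in>T. e < \<bar>Zn n \<omega> t - Zn n \<omega> (\<pi> t)\<bar>} < \<kappa>) sequentially"
    using discr[OF e \<kappa>] by blast
  have \<pi>T: "\<pi> t \<in> T" if "t \<in> T" for t
    using \<pi>[OF that] S by auto
  obtain J where J: "finite J" "J \<subseteq> T"
    and test: "\<And>z t. z \<in> K \<Longrightarrow> (\<And>t. t \<in> J \<Longrightarrow> \<bar>z t - z (\<pi> t)\<bar> \<le> 2 * e) \<Longrightarrow> t \<in> T \<Longrightarrow> \<bar>z t - z (\<pi> t)\<bar> \<le> 6 * e"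
    using compactin_linf_finite_test_set[where \<pi> = \<pi>, OF K(1)[unfolded m_def] e \<pi>T] by metis
  \<comment> \<open>The values on the net are spread over \<open>T\<close> as a step function.
    Composing \<open>G\<close> with \<open>ext\<close> gives a functional of the coordinates in
    \<open>S\<close> alone, defined on all of \<open>extensional S\<close>.\<close>
  define ext where "ext = (\<lambda>u :: 't \<Rightarrow> real. \<lambda>t\<in>T. u (\<pi> t))"
  have ext_in: "ext u \<in> mspace m" for u
    unfolding m_def mem_linf_iff
  proof (intro conjI exI[of _ "\<Sum>s\<in>S. \<bar>u s\<bar>"] ballI)
    fix t assume "t \<in> T"
    then show "\<bar>ext u t\<bar> \<le> (\<Sum>s\<in>S. \<bar>u s\<bar>)"
      using \<pi> S by (auto simp: ext_def intro!: member_le_sum)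
  qed (simp add: ext_def)
  have ext_restrict: "ext (restrict u S) = ext u" for u
    using \<pi> by (auto simp: ext_def)
  define \<Psi> where "\<Psi> = (\<lambda>u. G (ext u))"
  have \<Psi>_bdd: "\<bar>\<Psi> u\<bar> \<le> B" for u
    unfolding \<Psi>_def by (rule bdd[OF ext_in])
  have \<Psi>_cont: "continuous_on (extensional S) \<Psi>"
  proof (rule continuous_on_finitely_many_coordinates[OF S(1), of _ _ L])
    fix u v :: "'t \<Rightarrow> real"
    have "mdist m (ext u) (ext v) \<le> (\<Sum>s\<in>S. \<bar>u s - v s\<bar>)"
      unfolding m_def
    proof (rule mdist_linf_le)
      fix t assume "t \<in> T"
      then show "\<bar>ext u t - ext v t\<bar> \<le> (\<Sum>s\<in>S. \<bar>u s - v s\<bar>)"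
        using \<pi> S by (auto simp: ext_def intro!: member_le_sum[of "\<pi> t" S "\<lambda>s. \<bar>u s - v s\<bar>"])
    qed (simp add: sum_nonneg)
    then show "\<bar>\<Psi> u - \<Psi> v\<bar> \<le> L * (\<Sum>s\<in>S. \<bar>u s - v s\<bar>)"
      unfolding \<Psi>_def using lip[OF ext_in ext_in, of u v] L by (meson mult_left_mono order_trans)
  qed
  have close: "\<bar>G z - \<Psi> z\<bar> \<le> L * c"
    if z: "z \<in> mspace m" and c: "0 \<le> c" "\<And>t. t \<in> T \<Longrightarrow> \<bar>z t - z (\<pi> t)\<bar> \<le> c" for z c
  proof -
    have "mdist m z (ext z) \<le> c"
      unfolding m_def using c by (intro mdist_linf_le) (auto simp: ext_def)
    then show ?thesis
      unfolding \<Psi>_def using lip[OF z ext_in, of z] L by (meson mult_left_mono order_trans)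
  qed
  have far: "\<bar>G z - \<Psi> z\<bar> \<le> 2 * B" if z: "z \<in> mspace m" for z
    using bdd[OF z] \<Psi>_bdd[of z] by linarith
  have \<Psi>_restrict: "\<Psi> (restrict u S) = \<Psi> u" for u
    by (simp add: \<Psi>_def ext_restrict)
  have \<Psi>M: "(\<lambda>\<omega>. \<Psi> (Zn n \<omega>)) \<in> borel_measurable M" for n
    using borel_measurable_finitely_many_coordinates[OF S(1) \<Psi>_cont, of "Zn n" M] Zn_meas S
    by (auto simp: \<Psi>_restrict)
  have \<Psi>N: "(\<lambda>v. \<Psi> (Z v)) \<in> borel_measurable N"
    using borel_measurable_finitely_many_coordinates[OF S(1) \<Psi>_cont, of Z N] Z_meas S
    by (auto simp: \<Psi>_restrict)
  \<comment> \<open>A continuous substitute for the indicator that some test coordinate shows a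
    large error: 0 if all errors are at most \<open>e\<close>, 1 if one exceeds
    \<open>2 * e\<close>. The marginals can be tested only against continuous functions, hence the
    gap between the two thresholds.\<close>
  define \<phi> where "\<phi> = (\<lambda>u :: 't \<Rightarrow> real. min 1 (\<Sum>t\<in>J. max 0 ((\<bar>u t - u (\<pi> t)\<bar> - e) / e)))"
  have \<phi>01: "0 \<le> \<phi> u" "\<phi> u \<le> 1" for u
    by (auto simp: \<phi>_def intro!: sum_nonneg)
  have \<phi>_zero: "\<phi> u = 0" if "\<And>t. t \<in> J \<Longrightarrow> \<bar>u t - u (\<pi> t)\<bar> \<le> e" for u
  proof -
    have "(\<bar>u t - u (\<pi> t)\<bar> - e) / e \<le> 0" if "t \<in> J" for t
      using \<open>\<And>t. t \<in> J \<Longrightarrow> \<bar>u t - u (\<pi> t)\<bar> \<le> e\<close>[OF that] e by (simp add: divide_le_0_iff)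
    then show ?thesis
      unfolding \<phi>_def by (subst sum.neutral) (auto simp: max_absorb1)
  qed
  have \<phi>_one: "\<phi> u = 1" if "t \<in> J" "2 * e < \<bar>u t - u (\<pi> t)\<bar>" for u t
  proof -
    have "1 \<le> max 0 ((\<bar>u t - u (\<pi> t)\<bar> - e) / e)"
      using that e by (auto simp: le_max_iff_disj pos_le_divide_eq)
    also have "\<dots> \<le> (\<Sum>t\<in>J. max 0 ((\<bar>u t - u (\<pi> t)\<bar> - e) / e))"
      using that J by (intro member_le_sum) auto
    finally show ?thesis
      by (simp add: \<phi>_def)
  qed
  \<comment> \<open>\<open>\<phi>\<close> reads the coordinates in \<open>J\<close> and their images
    under \<open>\<pi>\<close>, which lie in \<open>S\<close>.\<close>
  define S' where "S' = J \<union> S"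
  have S': "finite S'" "S' \<subseteq> T"
    using J S by (auto simp: S'_def)
  have \<phi>_restrict: "\<phi> (restrict u S') = \<phi> u" for u
    unfolding \<phi>_def S'_def using J \<pi> by (auto intro!: arg_cong[of _ _ "min 1"] sum.cong)
  have \<phi>_cont: "continuous_on (extensional S') \<phi>"
    unfolding \<phi>_def using e
    by (intro continuous_intros continuous_on_coordinate) auto
  have \<phi>M: "(\<lambda>\<omega>. \<phi> (Zn n \<omega>)) \<in> borel_measurable M" for n
    using borel_measurable_finitely_many_coordinates[OF S'(1) \<phi>_cont, of "Zn n" M] Zn_meas S'
    by (auto simp: \<phi>_restrict)
  have \<phi>N: "(\<lambda>v. \<phi> (Z v)) \<in> borel_measurable N"
    using borel_measurable_finitely_many_coordinates[OF S'(1) \<phi>_cont, of Z N] Z_meas S'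
    by (auto simp: \<phi>_restrict)
  have "integrable M (\<lambda>\<omega>. \<Psi> (Zn n \<omega>))" "integrable N (\<lambda>v. \<Psi> (Z v))" "integrable N (\<lambda>v. G (Z v))" for n
    using \<Psi>M \<Psi>N GZ_meas \<Psi>_bdd bdd Zin
    by (auto intro!: M.integrable_const_bound[of _ B] N.integrable_const_bound[of _ B])
  moreover have "integrable M (\<lambda>\<omega>. \<phi> (Zn n \<omega>))" "integrable N (\<lambda>v. \<phi> (Z v))" for n
    using \<phi>M \<phi>N \<phi>01
    by (auto intro!: M.integrable_const_bound[of _ 1] N.integrable_const_bound[of _ 1])
  ultimately have int: "integrable M (\<lambda>\<omega>. \<Psi> (Zn n \<omega>))" "integrable M (\<lambda>\<omega>. \<phi> (Zn n \<omega>))"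
    "integrable N (\<lambda>v. \<Psi> (Z v))" "integrable N (\<lambda>v. \<phi> (Z v))" "integrable N (\<lambda>v. G (Z v))" for n
    by auto
  have approx_n: "\<bar>outer_exp M (\<lambda>\<omega>. G (Zn n \<omega>)) - integral\<^sup>L M (\<lambda>\<omega>. \<Psi> (Zn n \<omega>))\<bar> \<le> L * e + 2 * B * \<kappa>
      \<and> integral\<^sup>L M (\<lambda>\<omega>. \<phi> (Zn n \<omega>)) \<le> \<kappa>"
    if n: "outer_prob M {\<omega> \<in> space M. \<exists>t\<in>T. e < \<bar>Zn n \<omega> t - Zn n \<omega> (\<pi> t)\<bar>} < \<kappa>" for n
  proof -
    \<comment> \<open>One measurable cover of the bad event serves both claims: it bounds the error
      of the outer expectation, and its indicator dominates \<open>\<phi>\<close> along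
      \<open>Zn\<close>.\<close>
    obtain A where A: "A \<in> sets M"
      "{\<omega> \<in> space M. \<exists>t\<in>T. e < \<bar>Zn n \<omega> t - Zn n \<omega> (\<pi> t)\<bar>} \<inter> space M \<subseteq> A" "measure M A < \<kappa>"
      using n by (rule outer_prob_approx)
    have off: "\<bar>Zn n \<omega> t - Zn n \<omega> (\<pi> t)\<bar> \<le> e" if "\<omega> \<in> space M" "\<omega> \<notin> A" "t \<in> T" for \<omega> t
      using A(2) that by force
    have "\<bar>outer_exp M (\<lambda>\<omega>. G (Zn n \<omega>)) - integral\<^sup>L M (\<lambda>\<omega>. \<Psi> (Zn n \<omega>))\<bar> \<le> L * e + 2 * B * measure M A"
    proof (rule outer_exp_close[OF M int(1) A(1), of _ B])
      fix \<omega> assume \<omega>: "\<omega> \<in> space M"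
      show "\<bar>G (Zn n \<omega>)\<bar> \<le> B"
        using bdd[OF Zn[OF \<omega>]] .
      have Le: "0 \<le> L * e"
        using L e by simp
      show "\<bar>G (Zn n \<omega>) - \<Psi> (Zn n \<omega>)\<bar> \<le> L * e + 2 * B * indicator A \<omega>"
      proof (cases "\<omega> \<in> A")
        case True
        then show ?thesis
          using far[OF Zn[OF \<omega>], of n] Le by simp
      next
        case False
        have "\<bar>G (Zn n \<omega>) - \<Psi> (Zn n \<omega>)\<bar> \<le> L * e"
          using e by (intro close[OF Zn[OF \<omega>]] off[OF \<omega> False]) simp_all
        then show ?thesis
          using False by simp
      qed
    qed
    moreover have "2 * B * measure M A \<le> 2 * B * \<kappa>"
      using A B0 by (intro mult_left_mono) auto
    moreover have "integral\<^sup>L M (\<lambda>\<omega>. \<phi> (Zn n \<omega>)) \<le> integral\<^sup>L M (indicator A :: 'w \<Rightarrow> real)"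
    proof (rule integral_mono[OF int(2)])
      fix \<omega> assume "\<omega> \<in> space M"
      then show "\<phi> (Zn n \<omega>) \<le> indicator A \<omega>"
        using \<phi>01(2)[of "Zn n \<omega>"] \<phi>_zero[of "Zn n \<omega>"] off[of \<omega>] J(2)
        by (cases "\<omega> \<in> A") (simp_all add: subset_iff)
    qed (use A in \<open>simp add: M.emeasure_eq_measure\<close>)
    ultimately show ?thesis
      using A sets.sets_into_space[OF A(1)] by (simp add: Int_absorb2)
  qed
  have "(\<lambda>n. integral\<^sup>L M (\<lambda>\<omega>. \<phi> (restrict (Zn n \<omega>) S')))
      \<longlonglongrightarrow> integral\<^sup>L N (\<lambda>v. \<phi> (restrict (Z v) S'))"
  proof (rule fidi[OF S' \<phi>_cont])
    show "\<exists>B. \<forall>u\<in>extensional S'. \<bar>\<phi> u\<bar> \<le> B"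
      using \<phi>01 by (intro exI[of _ 1]) (simp add: abs_le_iff order_trans[of _ 0])
  qed
  then have "(\<lambda>n. integral\<^sup>L M (\<lambda>\<omega>. \<phi> (Zn n \<omega>))) \<longlonglongrightarrow> integral\<^sup>L N (\<lambda>v. \<phi> (Z v))"
    by (simp add: \<phi>_restrict)
  moreover have "eventually (\<lambda>n. integral\<^sup>L M (\<lambda>\<omega>. \<phi> (Zn n \<omega>)) \<le> \<kappa>) sequentially"
    using ev by eventually_elim (use approx_n in blast)
  \<comment> \<open>Here equicontinuity reaches the limit: \<open>Z\<close> inherits a small
    probability of large errors, but only at the test coordinates. Compactness of \<open>K\<close>
    extends this to all of \<open>T\<close>.\<close>
  ultimately have \<phi>_small: "integral\<^sup>L N (\<lambda>v. \<phi> (Z v)) \<le> \<kappa>"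
    by (intro tendsto_upperbound) auto
  define D where "D = Z -` K \<inter> space N"
  have D: "D \<in> sets N"
  proof -
    have "Hausdorff_space (mtopology_of m)"
      unfolding mtopology_of_def
      by (rule Metric_space.Hausdorff_space_mtopology) (rule Metric_space_mspace_mdist)
    then have "closedin (mtopology_of m) K"
      using K(1) by (rule compactin_imp_closedin)
    from measurable_sets[OF Z closedin_sets_borel_of[OF this]] show ?thesis
      unfolding D_def .
  qed
  have limit_close: "\<bar>integral\<^sup>L N (\<lambda>v. G (Z v)) - integral\<^sup>L N (\<lambda>v. \<Psi> (Z v))\<bar> \<le> 6 * (L * e) + 4 * B * \<kappa>"
  proof -
    \<comment> \<open>A path outside \<open>K\<close> is charged by the second summand, a path
      failing the test by the third, each with the trivial bound \<open>2 * B\<close>. Every other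
      path has discretisation error at most \<open>6 * e\<close>.\<close>
    let ?W = "\<lambda>v. L * (6 * e) + 2 * B * (1 - indicator D v) + 2 * B * \<phi> (Z v)"
    have "\<bar>G (Z v) - \<Psi> (Z v)\<bar> \<le> ?W v" if v: "v \<in> space N" for v
    proof (cases "v \<in> D \<and> (\<forall>t\<in>J. \<bar>Z v t - Z v (\<pi> t)\<bar> \<le> 2 * e)")
      case True
      then have "\<bar>Z v t - Z v (\<pi> t)\<bar> \<le> 6 * e" if "t \<in> T" for t
        using that by (intro test) (auto simp: D_def)
      then have "\<bar>G (Z v) - \<Psi> (Z v)\<bar> \<le> L * (6 * e)"
        using e by (intro close[OF Zin[OF v]]) auto
      moreover have "0 \<le> 2 * B * (1 - indicator D v)" "0 \<le> 2 * B * \<phi> (Z v)"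
        using B0 \<phi>01 by (auto simp: indicator_def)
      ultimately show ?thesis
        by linarith
    next
      case False
      then have "2 * B \<le> 2 * B * (1 - indicator D v) + 2 * B * \<phi> (Z v)"
        using \<phi>_one[of _ "Z v"] B0 \<phi>01[of "Z v"] by (cases "v \<in> D") (auto simp: not_le)
      moreover have "0 \<le> L * (6 * e)"
        using L e by simp
      ultimately show ?thesis
        using far[OF Zin[OF v]] by linarith
    qed
    then have "integral\<^sup>L N (\<lambda>v. \<bar>G (Z v) - \<Psi> (Z v)\<bar>) \<le> integral\<^sup>L N ?W"
      using int D by (intro integral_mono) (auto simp: N.emeasure_eq_measure)
    also have "integral\<^sup>L N ?W = L * (6 * e) + 2 * B * (1 - measure N D) + 2 * B * integral\<^sup>L N (\<lambda>v. \<phi> (Z v))"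
      using int D by (simp add: N.prob_space N.emeasure_eq_measure)
    also have "\<dots> \<le> L * (6 * e) + 2 * B * \<kappa> + 2 * B * \<kappa>"
      using K(2) \<phi>_small B0 L unfolding D_def[symmetric] by (intro add_mono mult_left_mono) auto
    finally have "integral\<^sup>L N (\<lambda>v. \<bar>G (Z v) - \<Psi> (Z v)\<bar>) \<le> 6 * (L * e) + 4 * B * \<kappa>"
      by simp
    moreover have "\<bar>integral\<^sup>L N (\<lambda>v. G (Z v) - \<Psi> (Z v))\<bar> \<le> integral\<^sup>L N (\<lambda>v. \<bar>G (Z v) - \<Psi> (Z v)\<bar>)"
      by (rule integral_abs_bound)
    ultimately show ?thesis
      using int by simp
  qed
  have "(\<lambda>n. integral\<^sup>L M (\<lambda>\<omega>. \<Psi> (restrict (Zn n \<omega>) S)))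
      \<longlonglongrightarrow> integral\<^sup>L N (\<lambda>v. \<Psi> (restrict (Z v) S))"
    using \<Psi>_bdd by (intro fidi[OF S \<Psi>_cont]) blast
  then have "(\<lambda>n. integral\<^sup>L M (\<lambda>\<omega>. \<Psi> (Zn n \<omega>))) \<longlonglongrightarrow> integral\<^sup>L N (\<lambda>v. \<Psi> (Z v))"
    by (simp add: \<Psi>_restrict)
  from tendstoD[OF this \<kappa>] ev
  show "eventually (\<lambda>n. dist (outer_exp M (\<lambda>\<omega>. G (Zn n \<omega>))) (integral\<^sup>L N (\<lambda>v. G (Z v))) < x) sequentially"
  proof eventually_elim
    case (elim n)
    have "\<bar>outer_exp M (\<lambda>\<omega>. G (Zn n \<omega>)) - integral\<^sup>L M (\<lambda>\<omega>. \<Psi> (Zn n \<omega>))\<bar> \<le> L * e + 2 * B * \<kappa>"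
      using approx_n[OF elim(2)] ..
    then have "\<bar>outer_exp M (\<lambda>\<omega>. G (Zn n \<omega>)) - integral\<^sup>L N (\<lambda>v. G (Z v))\<bar>
        \<le> (L * e + 2 * B * \<kappa>) + \<kappa> + (6 * (L * e) + 4 * B * \<kappa>)"
      using elim(1) limit_close unfolding dist_real_def by linarith
    also have "\<dots> = 7 * (L * e) + (6 * B + 1) * \<kappa>"
      by (simp add: algebra_simps)
    finally show ?case
      using budget by (simp add: dist_real_def)
  qed
qed

section \<open>Sequential empirical processes\<close>

text \<open>Rounding down to multiples of \<open>1 / k\<close> keeps the net points inside the
  interval, where the process is defined.\<close>

lemma unit_interval_net:
  assumes "0 < (e::real)"
  obtains S \<pi> where "finite S" "S \<subseteq> {0..1}" "\<And>t. t \<in> {0..1} \<Longrightarrow> \<pi> t \<in> S \<and> \<bar>t - \<pi> t\<bar> \<le> e"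
proof -
  obtain k :: nat where k: "0 < k" "1 / real k < e"
    using assms nat_approx_posE by (metis inverse_eq_divide of_nat_0_less_iff zero_less_Suc)
  define \<pi> where "\<pi> = (\<lambda>t. real (nat \<lfloor>real k * t\<rfloor>) / real k)"
  show ?thesis
  proof (rule that[of "(\<lambda>i. real i / real k) ` {..k}" \<pi>])
    show "(\<lambda>i. real i / real k) ` {..k} \<subseteq> {0..1}"
      using k by (auto simp: field_simps)
    fix t :: real assume t: "t \<in> {0..1}"
    have "0 \<le> real k * t"
      using t by simp
    then have "\<bar>real k * t - real (nat \<lfloor>real k * t\<rfloor>)\<bar> \<le> 1"
      by linarith
    then have "\<bar>real k * t - real (nat \<lfloor>real k * t\<rfloor>)\<bar> / real k \<le> 1 / real k"
      using k by (intro divide_right_mono) auto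
    moreover have "t - \<pi> t = (real k * t - real (nat \<lfloor>real k * t\<rfloor>)) / real k"
      using k by (simp add: \<pi>_def diff_divide_distrib)
    then have "\<bar>real k * t - real (nat \<lfloor>real k * t\<rfloor>)\<bar> / real k = \<bar>t - \<pi> t\<bar>"
      by (simp add: abs_divide)
    ultimately have "\<bar>t - \<pi> t\<bar> \<le> e"
      using k by linarith
    moreover have "\<pi> t \<in> (\<lambda>i. real i / real k) ` {..k}"
      unfolding \<pi>_def using nat_floor_mult_le[OF t, of k] by auto
    ultimately show "\<pi> t \<in> (\<lambda>i. real i / real k) ` {..k} \<and> \<bar>t - \<pi> t\<bar> \<le> e"
      by simp
  qed simp
qed

text \<open>The marginal on a finite \<open>S\<close> lives on \<open>extensional S\<close>, a copy
  of the Euclidean space indexed by \<open>S\<close> with the topology inherited from the product.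
  Its expectations are ordinary integrals because each single coordinate of \<open>Zproc\<close> is
  measurable.\<close>

theorem theorem2p3:
  fixes M :: "'w measure" and MX :: "'x measure"
    and X :: "nat \<Rightarrow> nat \<Rightarrow> 'w \<Rightarrow> 'x"
    and \<F> :: "('x \<Rightarrow> real) set" and F :: "'x \<Rightarrow> real"
    and \<rho> :: "('x \<Rightarrow> real) \<Rightarrow> ('x \<Rightarrow> real) \<Rightarrow> real"
    and \<nu> :: real and g :: "nat \<Rightarrow> real \<Rightarrow> real" and h :: "nat \<Rightarrow> real"
    and N :: "'v measure" and Z :: "'v \<Rightarrow> (real \<times> ('x \<Rightarrow> real) \<Rightarrow> real)"
  assumes P: "prob_space M"
    and X_meas: "\<And>i n. 1 \<le> i \<Longrightarrow> i \<le> n \<Longrightarrow> X i n \<in> measurable M MX"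
    and F_meas: "\<And>f. f \<in> \<F> \<Longrightarrow> f \<in> borel_measurable MX"
    and env_meas: "F \<in> borel_measurable MX"
    and env: "\<And>f x. f \<in> \<F> \<Longrightarrow> x \<in> space MX \<Longrightarrow> \<bar>f x\<bar> \<le> F x"
    and env_int: "\<And>i n. 1 \<le> i \<Longrightarrow> i \<le> n \<Longrightarrow> integrable M (\<lambda>\<omega>. F (X i n \<omega>))"
    and nu: "\<nu> > 2"
    and rho: "semimetric_on \<F> \<rho>"
    and A1: "\<And>n i j \<delta>. \<delta> > 0 \<Longrightarrow> 1 \<le> i \<Longrightarrow> i \<le> j \<Longrightarrow> j \<le> n \<Longrightarrow>
               outer_nn_exp M (\<lambda>\<omega>. SUP f \<in> Fdelta \<F> \<rho> \<delta>. ennreal (\<bar>SZo M X n i j f \<omega>\<bar> powr \<nu>))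
                 \<le> ennreal (g (j - i + 1) \<delta> powr (\<nu> / 2))"
    and A1S: "\<exists>Qg. 1 \<le> Qg \<and> Qg < 2 powr (1 - 2 / \<nu>) \<and>
               (\<forall>\<delta>>0. cond_S (\<nu> / 2) (\<lambda>k. g k \<delta>) Qg)"
    and A2: "\<And>n i j. 1 \<le> i \<Longrightarrow> i \<le> j \<Longrightarrow> j \<le> n \<Longrightarrow>
               outer_nn_exp M (\<lambda>\<omega>. SUP f \<in> \<F>. ennreal (\<bar>SZo M X n i j f \<omega>\<bar> powr \<nu>))
                 \<le> ennreal (h (j - i + 1) powr (\<nu> / 2))"
    and A2S: "\<exists>Qh. 1 \<le> Qh \<and> Qh < 2 powr (1 - 2 / \<nu>) \<and> cond_S (\<nu> / 2) h Qh"
    and A3: "((\<lambda>\<delta>. limsup (\<lambda>n. ereal (g n \<delta> / real n))) \<longlongrightarrow> 0) (at_right 0)"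
    and A4: "\<exists>C\<ge>0. \<forall>\<epsilon>. 0 < \<epsilon> \<and> \<epsilon> \<le> 1 \<longrightarrow>
               limsup (\<lambda>n. ereal ((let k = nat \<lfloor>real n * \<epsilon>\<rfloor> in if k = 0 then 0 else h k) / real n))
                 \<le> ereal (C * \<epsilon>)"
  shows "(\<forall>\<epsilon>>0. ((\<lambda>\<delta>. limsup (\<lambda>n. ereal (outer_prob M
              {\<omega> \<in> space M. \<exists>s t f1 f2. s \<in> {0..1} \<and> t \<in> {0..1} \<and> f1 \<in> \<F> \<and> f2 \<in> \<F> \<and>
                  \<bar>s - t\<bar> + \<rho> f1 f2 \<le> \<delta> \<and>
                  \<bar>seqemp M X n s f1 \<omega> - seqemp M X n t f2 \<omega>\<bar> > \<epsilon>})))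
             \<longlongrightarrow> 0) (at_right 0))
    \<and> (totally_bounded_semi \<F> \<rho> \<longrightarrow>
        (prob_space N \<longrightarrow>
           Z \<in> measurable N (borel_of (mtopology_of (linf \<F>))) \<longrightarrow>
           (\<forall>e>0. \<exists>K. compactin (mtopology_of (linf \<F>)) K \<and>
                       measure N (Z -` K \<inter> space N) \<ge> 1 - e) \<longrightarrow>
           (\<forall>S. finite S \<and> S \<subseteq> idx \<F> \<longrightarrow>
              (\<forall>\<phi> :: (real \<times> ('x \<Rightarrow> real) \<Rightarrow> real) \<Rightarrow> real.
                 continuous_on (extensional S) \<phi> \<and> (\<exists>B. \<forall>u \<in> extensional S. \<bar>\<phi> u\<bar> \<le> B) \<longrightarrow>
                 (\<lambda>n. integral\<^sup>L M (\<lambda>\<omega>. \<phi> (restrict (Zproc M X \<F> n \<omega>) S)))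
                   \<longlonglongrightarrow> integral\<^sup>L N (\<lambda>v. \<phi> (restrict (Z v) S)))) \<longrightarrow>
           (\<forall>H :: (real \<times> ('x \<Rightarrow> real) \<Rightarrow> real) \<Rightarrow> real.
              continuous_map (mtopology_of (linf \<F>)) euclideanreal H \<and>
              (\<exists>B. \<forall>z \<in> mspace (linf \<F>). \<bar>H z\<bar> \<le> B) \<longrightarrow>
              (\<lambda>n. outer_exp M (\<lambda>\<omega>. H (Zproc M X \<F> n \<omega>)))
                \<longlonglongrightarrow> integral\<^sup>L N (\<lambda>v. H (Z v)))))"
proof -
  interpret prob_space M by (rule P)
  have XX: "X i n \<omega> \<in> space MX" if "1 \<le> i" "i \<le> n" "\<omega> \<in> space M" for i n \<omega>
    using measurable_space[OF X_meas[OF that(1,2)] that(3)] .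
  have fX: "(\<lambda>\<omega>. f (X i n \<omega>)) \<in> borel_measurable M" if "f \<in> \<F>" "1 \<le> i" "i \<le> n" for f i n
    using measurable_compose[OF X_meas[OF that(2,3)] F_meas[OF that(1)]] .
  have int: "integrable M (\<lambda>\<omega>. f (X i n \<omega>))" if "f \<in> \<F>" "1 \<le> i" "i \<le> n" for f i n
  proof (rule Bochner_Integration.integrable_bound[OF env_int[OF that(2,3)] fX[OF that]])
    show "AE \<omega> in M. norm (f (X i n \<omega>)) \<le> norm (F (X i n \<omega>))"
      using env[OF that(1) XX[OF that(2,3)]] by (intro AE_I2) force
  qed
  obtain Qg where Qg: "\<And>\<delta>. \<delta> > 0 \<Longrightarrow> cond_S (\<nu> / 2) (\<lambda>k. g k \<delta>) Qg"
    using A1S by blast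
  obtain Qh where Qh: "cond_S (\<nu> / 2) h Qh"
    using A2S by blast
  obtain C where C: "0 \<le> C" "\<And>\<epsilon>. 0 < \<epsilon> \<Longrightarrow> \<epsilon> \<le> 1 \<Longrightarrow>
      limsup (\<lambda>n. ereal ((let k = nat \<lfloor>real n * \<epsilon>\<rfloor> in if k = 0 then 0 else h k) / real n)) \<le> ereal (C * \<epsilon>)"
    using A4 by blast
  have rho_nonneg: "0 \<le> \<rho> f f'" if "f \<in> \<F>" "f' \<in> \<F>" for f f'
    using rho that unfolding semimetric_on_def by blast
  define E where "E n \<delta> \<epsilon> = {\<omega> \<in> space M. \<exists>s t f1 f2. s \<in> {0..1} \<and> t \<in> {0..1} \<and> f1 \<in> \<F> \<and> f2 \<in> \<F> \<and>
      \<bar>s - t\<bar> + \<rho> f1 f2 \<le> \<delta> \<and> \<bar>seqemp M X n s f1 \<omega> - seqemp M X n t f2 \<omega>\<bar> > \<epsilon>}" for n \<delta> \<epsilon>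
  have aec: "((\<lambda>\<delta>. limsup (\<lambda>n. ereal (outer_prob M (E n \<delta> \<epsilon>)))) \<longlongrightarrow> 0) (at_right 0)" if "0 < \<epsilon>" for \<epsilon>
    unfolding E_def
    by (rule asymptotic_equicontinuity[OF finite_measure_axioms int nu rho_nonneg A1 Qg A2 Qh A3 C that])
  have bounded: "\<exists>B. \<forall>p\<in>idx \<F>. \<bar>Zproc M X \<F> n \<omega> p\<bar> \<le> B" if \<omega>: "\<omega> \<in> space M" for n \<omega>
  proof (intro exI ballI)
    fix p assume p: "p \<in> idx \<F>"
    then obtain t f where tf: "p = (t, f)" "t \<in> {0..1}" "f \<in> \<F>"
      by (auto simp: idx_def)
    let ?k = "nat \<lfloor>real n * t\<rfloor>"
    let ?b = "\<lambda>i. F (X i n \<omega>) + integral\<^sup>L M (\<lambda>\<omega>'. F (X i n \<omega>'))"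
    have k: "?k \<le> n"
      using nat_floor_mult_le[OF tf(2)] .
    have b: "\<bar>f (X i n \<omega>) - integral\<^sup>L M (\<lambda>\<omega>'. f (X i n \<omega>'))\<bar> \<le> ?b i" if "1 \<le> i" "i \<le> n" for i
    proof -
      have "\<bar>integral\<^sup>L M (\<lambda>\<omega>'. f (X i n \<omega>'))\<bar> \<le> integral\<^sup>L M (\<lambda>\<omega>'. \<bar>f (X i n \<omega>')\<bar>)"
        by (rule integral_abs_bound)
      also have "\<dots> \<le> integral\<^sup>L M (\<lambda>\<omega>'. F (X i n \<omega>'))"
        using int[OF tf(3) that] env_int[OF that] env[OF tf(3) XX[OF that]]
        by (intro integral_mono) auto
      finally show ?thesis
        using env[OF tf(3) XX[OF that \<omega>]] by linarith
    qed
    have "\<bar>\<Sum>i=1..?k. f (X i n \<omega>) - integral\<^sup>L M (\<lambda>\<omega>'. f (X i n \<omega>'))\<bar> \<le> (\<Sum>i=1..?k. ?b i)"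
      using b k by (intro order_trans[OF sum_abs] sum_mono) auto
    \<comment> \<open>Summing over all \<open>i\<close> up to \<open>n\<close> removes the
      dependence on \<open>t\<close>, as the envelope removed that on \<open>f\<close>. The path is
      therefore bounded on the whole index set and belongs to \<open>linf\<close>.\<close>
    also have "\<dots> \<le> (\<Sum>i=1..n. ?b i)"
    proof (rule sum_mono2)
      show "0 \<le> ?b i" if "i \<in> {1..n} - {1..?k}" for i
        using b[of i] that by (intro order_trans[OF abs_ge_zero]) auto
    qed (use k in auto)
    finally show "\<bar>Zproc M X \<F> n \<omega> p\<bar> \<le> 1 / sqrt (real n) * (\<Sum>i=1..n. ?b i)"
      using p tf(1) by (auto simp: Zproc_def seqemp_def abs_mult intro!: divide_right_mono)
  qed
  have Zproc_in: "Zproc M X \<F> n \<omega> \<in> mspace (linf \<F>)" if "\<omega> \<in> space M" for n \<omega>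
    unfolding linf_def mem_linf_iff using bounded[OF that] by (auto simp: Zproc_def)
  have Zproc_meas: "(\<lambda>\<omega>. Zproc M X \<F> n \<omega> p) \<in> borel_measurable M" if p: "p \<in> idx \<F>" for n p
  proof -
    obtain t f where tf: "p = (t, f)" "t \<in> {0..1}" "f \<in> \<F>"
      using p by (auto simp: idx_def)
    have "(\<lambda>\<omega>. seqemp M X n t f \<omega>) \<in> borel_measurable M"
      unfolding seqemp_def using nat_floor_mult_le[OF tf(2), of n] fX[OF tf(3)]
      by (intro borel_measurable_times borel_measurable_sum borel_measurable_diff borel_measurable_const) auto
    then show ?thesis
      using p tf(1) by (simp add: Zproc_def)
  qed
  have discr: "\<exists>\<pi> S. finite S \<and> S \<subseteq> idx \<F> \<and> (\<forall>p\<in>idx \<F>. \<pi> p \<in> S) \<and>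
        eventually (\<lambda>n. outer_prob M {\<omega> \<in> space M. \<exists>p\<in>idx \<F>.
          e < \<bar>Zproc M X \<F> n \<omega> p - Zproc M X \<F> n \<omega> (\<pi> p)\<bar>} < \<eta>) sequentially"
    if tb: "totally_bounded_semi \<F> \<rho>" and e: "0 < e" and \<eta>: "0 < \<eta>" for e \<eta> :: real
  proof -
    have "eventually (\<lambda>\<delta>. limsup (\<lambda>n. ereal (outer_prob M (E n \<delta> e))) < ereal \<eta>) (at_right 0)"
      using aec[OF e] \<eta> by (intro order_tendstoD(2)) auto
    with eventually_at_right_less[of 0]
    have "eventually (\<lambda>\<delta>. 0 < \<delta> \<and> limsup (\<lambda>n. ereal (outer_prob M (E n \<delta> e))) < ereal \<eta>) (at_right 0)"
      by eventually_elim auto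
    from eventually_happens[OF this] obtain \<delta> where
      \<delta>: "0 < \<delta>" "limsup (\<lambda>n. ereal (outer_prob M (E n \<delta> e))) < ereal \<eta>"
      by auto
    obtain S1 \<pi>1 where S1: "finite S1" "S1 \<subseteq> {0..1}"
      "\<And>t. t \<in> {0..1} \<Longrightarrow> \<pi>1 t \<in> S1 \<and> \<bar>t - \<pi>1 t\<bar> \<le> \<delta> / 2"
      using unit_interval_net[of "\<delta> / 2"] \<delta>(1) by auto
    obtain S2 where S2: "finite S2" "S2 \<subseteq> \<F>" "\<forall>f\<in>\<F>. \<exists>k\<in>S2. \<rho> f k < \<delta> / 2"
      using tb \<delta>(1) unfolding totally_bounded_semi_def by (meson half_gt_zero)
    then obtain \<pi>2 where \<pi>2: "\<And>f. f \<in> \<F> \<Longrightarrow> \<pi>2 f \<in> S2 \<and> \<rho> f (\<pi>2 f) < \<delta> / 2"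
      by metis
    \<comment> \<open>Net radius \<open>\<delta> / 2\<close> in each factor keeps a point and its
      image within \<open>\<delta>\<close> for the sum semimetric. The centres in \<open>S2\<close>
      belong to \<open>\<F>\<close>, so the error event is contained in
      \<open>E n \<delta> e\<close>.\<close>
    define \<pi> where "\<pi> = (\<lambda>(t, f). (\<pi>1 t, \<pi>2 f))"
    have sub: "{\<omega> \<in> space M. \<exists>p\<in>idx \<F>. e < \<bar>Zproc M X \<F> n \<omega> p - Zproc M X \<F> n \<omega> (\<pi> p)\<bar>} \<subseteq> E n \<delta> e" for n
    proof clarify
      fix \<omega> t f assume \<omega>: "\<omega> \<in> space M" and tf: "(t, f) \<in> idx \<F>"
        and gt: "e < \<bar>Zproc M X \<F> n \<omega> (t, f) - Zproc M X \<F> n \<omega> (\<pi> (t, f))\<bar>"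
      have t: "t \<in> {0..1}" "\<pi>1 t \<in> {0..1}" "\<bar>t - \<pi>1 t\<bar> \<le> \<delta> / 2"
        and f: "f \<in> \<F>" "\<pi>2 f \<in> \<F>" "\<rho> f (\<pi>2 f) < \<delta> / 2"
        using tf S1(2) S1(3)[of t] S2(2) \<pi>2[of f] by (auto simp: idx_def)
      have "e < \<bar>seqemp M X n t f \<omega> - seqemp M X n (\<pi>1 t) (\<pi>2 f) \<omega>\<bar>"
        using gt t f by (simp add: Zproc_def \<pi>_def idx_def)
      moreover have "\<bar>t - \<pi>1 t\<bar> + \<rho> f (\<pi>2 f) \<le> \<delta>"
        using t f by linarith
      ultimately show "\<omega> \<in> E n \<delta> e"
        unfolding E_def using \<omega> t f by blast
    qed
    have "eventually (\<lambda>n. ereal (outer_prob M (E n \<delta> e)) < ereal \<eta>) sequentially"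
      using \<delta>(2) by (rule Limsup_lessD)
    then have "eventually (\<lambda>n. outer_prob M {\<omega> \<in> space M. \<exists>p\<in>idx \<F>.
          e < \<bar>Zproc M X \<F> n \<omega> p - Zproc M X \<F> n \<omega> (\<pi> p)\<bar>} < \<eta>) sequentially"
    proof eventually_elim
      case (elim n)
      have "outer_prob M {\<omega> \<in> space M. \<exists>p\<in>idx \<F>.
          e < \<bar>Zproc M X \<F> n \<omega> p - Zproc M X \<F> n \<omega> (\<pi> p)\<bar>} \<le> outer_prob M (E n \<delta> e)"
        using sub by (intro outer_prob_mono) blast
      then show ?case
        using elim by simp
    qed
    moreover have "finite (S1 \<times> S2)" "S1 \<times> S2 \<subseteq> idx \<F>" "\<forall>p\<in>idx \<F>. \<pi> p \<in> S1 \<times> S2"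
      using S1 S2 \<pi>2 by (auto simp: idx_def \<pi>_def)
    ultimately show ?thesis
      by blast
  qed
  show ?thesis
  proof (intro conjI impI allI)
    fix \<epsilon> :: real assume "0 < \<epsilon>"
    from aec[OF this] show "((\<lambda>\<delta>. limsup (\<lambda>n. ereal (outer_prob M
              {\<omega> \<in> space M. \<exists>s t f1 f2. s \<in> {0..1} \<and> t \<in> {0..1} \<and> f1 \<in> \<F> \<and> f2 \<in> \<F> \<and>
                  \<bar>s - t\<bar> + \<rho> f1 f2 \<le> \<delta> \<and>
                  \<bar>seqemp M X n s f1 \<omega> - seqemp M X n t f2 \<omega>\<bar> > \<epsilon>}))) \<longlongrightarrow> 0) (at_right 0)"
      unfolding E_def .
  next
    fix H :: "(real \<times> ('x \<Rightarrow> real) \<Rightarrow> real) \<Rightarrow> real"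
    assume tb: "totally_bounded_semi \<F> \<rho>" and N: "prob_space N"
      and Z: "Z \<in> measurable N (borel_of (mtopology_of (linf \<F>)))"
      and tight: "\<forall>e>0. \<exists>K. compactin (mtopology_of (linf \<F>)) K \<and> measure N (Z -` K \<inter> space N) \<ge> 1 - e"
      and fidi: "\<forall>S. finite S \<and> S \<subseteq> idx \<F> \<longrightarrow>
              (\<forall>\<phi> :: (real \<times> ('x \<Rightarrow> real) \<Rightarrow> real) \<Rightarrow> real.
                 continuous_on (extensional S) \<phi> \<and> (\<exists>B. \<forall>u \<in> extensional S. \<bar>\<phi> u\<bar> \<le> B) \<longrightarrow>
                 (\<lambda>n. integral\<^sup>L M (\<lambda>\<omega>. \<phi> (restrict (Zproc M X \<F> n \<omega>) S)))
                   \<longlonglongrightarrow> integral\<^sup>L N (\<lambda>v. \<phi> (restrict (Z v) S)))"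
      and H: "continuous_map (mtopology_of (linf \<F>)) euclideanreal H \<and> (\<exists>B. \<forall>z \<in> mspace (linf \<F>). \<bar>H z\<bar> \<le> B)"
    obtain B where B: "\<And>z. z \<in> mspace (linf \<F>) \<Longrightarrow> \<bar>H z\<bar> \<le> B"
      using H by blast
    have lip: "(\<lambda>n. outer_exp M (\<lambda>\<omega>. G (Zproc M X \<F> n \<omega>))) \<longlonglongrightarrow> integral\<^sup>L N (\<lambda>v. G (Z v))"
      if "0 \<le> L" "\<And>z. z \<in> mspace (linf \<F>) \<Longrightarrow> \<bar>G z\<bar> \<le> B'"
        "\<And>x y. x \<in> mspace (linf \<F>) \<Longrightarrow> y \<in> mspace (linf \<F>) \<Longrightarrow> \<bar>G x - G y\<bar> \<le> L * mdist (linf \<F>) x y"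
      for G L B'
    proof (rule outer_exp_tendsto_of_discretisation[where T = "idx \<F>" and Zn = "Zproc M X \<F>" and Z = Z
          and G = G and L = L and B = B', folded linf_def, OF P N Zproc_in Zproc_meas Z _ _ _ that])
      show "\<exists>\<pi> S. finite S \<and> S \<subseteq> idx \<F> \<and> (\<forall>p\<in>idx \<F>. \<pi> p \<in> S) \<and>
        eventually (\<lambda>n. outer_prob M {\<omega> \<in> space M. \<exists>p\<in>idx \<F>.
          e < \<bar>Zproc M X \<F> n \<omega> p - Zproc M X \<F> n \<omega> (\<pi> p)\<bar>} < \<eta>) sequentially"
        if "0 < e" "0 < \<eta>" for e \<eta>
        using tb that by (rule discr)
    next
      show "\<exists>K. compactin (mtopology_of (linf \<F>)) K \<and> measure N (Z -` K \<inter> space N) \<ge> 1 - e" if "0 < e" for e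
        using tight[rule_format, OF that] .
    next
      fix S and \<phi> :: "(real \<times> ('x \<Rightarrow> real) \<Rightarrow> real) \<Rightarrow> real"
      assume "finite S" "S \<subseteq> idx \<F>" "continuous_on (extensional S) \<phi>"
        "\<exists>B. \<forall>u \<in> extensional S. \<bar>\<phi> u\<bar> \<le> B"
      then show "(\<lambda>n. integral\<^sup>L M (\<lambda>\<omega>. \<phi> (restrict (Zproc M X \<F> n \<omega>) S)))
          \<longlonglongrightarrow> integral\<^sup>L N (\<lambda>v. \<phi> (restrict (Z v) S))"
        by (intro fidi[rule_format] conjI)
    qed
    show "(\<lambda>n. outer_exp M (\<lambda>\<omega>. H (Zproc M X \<F> n \<omega>))) \<longlonglongrightarrow> integral\<^sup>L N (\<lambda>v. H (Z v))"
    proof (rule outer_exp_tendsto_of_Lipschitz[OF finite_measure_axioms _ Zproc_in Z lip _ B])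
      show "finite_measure N"
        using N by (rule prob_space.finite_measure)
    qed (use H in blast)+
  qed
qed

end
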